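(* There is an algorithm that, given a finite simple undirected graph $G=(V,E)$ with $n$ vertices and integers $k\ge 1$, $t\ge 0$, decides whether there exists a non-empty set $X\subseteq V$ with $|X|\le k$ and $|N(X)|\le t$ (the problem \textsc{Cutting at Most $k$ Vertices}), and runs in time $4^{t}\cdot n^{O(1)}$. In particular, \textsc{Cutting at Most $k$ Vertices} is fixed-parameter tractable when parameterized by $t$ alone.
   Context: All graphs are finite, simple and undirected. For $U\subseteq V$, $N(U)=\bigcup_{v\in U}N(v)\setminus U$ is the open vertex-neighborhood of $U$. A parameterized problem is fixed-parameter tractable if it can be solved in time $f(p)\cdot n^{O(1)}$ for some computable function $f$ of the parameter $p$. *)

theory Defs
  imports "Graph_Theory.Graph_Theory"
begin

section \<open>Model of computation\<close>

text \<open>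
  Algorithms are programs of a deterministic first-order functional language over binary trees, in
  the style of the languages F and WHILE of N. D. Jones (Computability and Complexity from a
  Programming Perspective, MIT Press 1997). The only primitives are building a cell, taking its
  components and testing for \<open>Null\<close>. With trees represented as pointers to shared immutable cells,
  each evaluation rule below takes constant time on a random access machine (the constant depends
  only on the program), so a cost bound is a running time bound up to a constant factor.
\<close>

datatype val = Null | Cell val val

fun val_fst :: "val \<Rightarrow> val" where
  "val_fst Null = Null"
| "val_fst (Cell a b) = a"

fun val_snd :: "val \<Rightarrow> val" where
  "val_snd Null = Null"
| "val_snd (Cell a b) = b"

text \<open>
  Variables are de Bruijn indices into the environment. The body of a function is evaluated in the
  environment consisting of its arguments, and \<open>LetE\<close> pushes one further value to the front.
\<close>

datatype exp =
    VarE nat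
  | NullE
  | CellE exp exp
  | FstE exp
  | SndE exp
  | IfE exp exp exp \<comment> \<open>takes the first branch iff the condition is not \<open>Null\<close>\<close>
  | LetE exp exp
  | CallE nat "exp list"

text \<open>A program is a finite list of function bodies. Function \<open>0\<close> is the main function.\<close>

type_synonym program = "exp list"

text \<open>
  \<open>eval p env e v c\<close>: expression \<open>e\<close> evaluates to \<open>v\<close> at cost \<open>c\<close>. Evaluations that diverge or get
  stuck on an undefined variable or function have no derivation.
\<close>

inductive eval :: "program \<Rightarrow> val list \<Rightarrow> exp \<Rightarrow> val \<Rightarrow> nat \<Rightarrow> bool"
  and evals :: "program \<Rightarrow> val list \<Rightarrow> exp list \<Rightarrow> val list \<Rightarrow> nat \<Rightarrow> bool"
  for p :: program
where
  eval_Var: "i < length env \<Longrightarrow> eval p env (VarE i) (env ! i) 1"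
| eval_Null: "eval p env NullE Null 1"
| eval_Cell: "eval p env a v c \<Longrightarrow> eval p env b w d \<Longrightarrow>
    eval p env (CellE a b) (Cell v w) (c + d + 1)"
| eval_Fst: "eval p env a v c \<Longrightarrow> eval p env (FstE a) (val_fst v) (c + 1)"
| eval_Snd: "eval p env a v c \<Longrightarrow> eval p env (SndE a) (val_snd v) (c + 1)"
| eval_If_True: "eval p env b v c \<Longrightarrow> v \<noteq> Null \<Longrightarrow> eval p env a1 w d \<Longrightarrow>
    eval p env (IfE b a1 a2) w (c + d + 1)"
| eval_If_False: "eval p env b Null c \<Longrightarrow> eval p env a2 w d \<Longrightarrow>
    eval p env (IfE b a1 a2) w (c + d + 1)"
| eval_Let: "eval p env a v c \<Longrightarrow> eval p (v # env) b w d \<Longrightarrow>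
    eval p env (LetE a b) w (c + d + 1)"
| eval_Call: "f < length p \<Longrightarrow> evals p env as vs c \<Longrightarrow> eval p vs (p ! f) w d \<Longrightarrow>
    eval p env (CallE f as) w (c + d + 1)"
| evals_Nil: "evals p env [] [] 0"
| evals_Cons: "eval p env a v c \<Longrightarrow> evals p env as vs d \<Longrightarrow>
    evals p env (a # as) (v # vs) (c + d)"

inductive_cases eval_VarE: "eval p env (VarE i) v c"
inductive_cases eval_NullE: "eval p env NullE v c"
inductive_cases eval_CellE: "eval p env (CellE a b) v c"
inductive_cases eval_FstE: "eval p env (FstE a) v c"
inductive_cases eval_SndE: "eval p env (SndE a) v c"
inductive_cases eval_IfE: "eval p env (IfE a b d) v c"
inductive_cases eval_LetE: "eval p env (LetE a b) v c"
inductive_cases eval_CallE: "eval p env (CallE f as) v c"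
inductive_cases evals_NilE: "evals p env [] vs c"
inductive_cases evals_ConsE: "evals p env (a # as) vs c"

lemma eval_deterministic:
  "eval p env e v c \<Longrightarrow> eval p env e v' c' \<Longrightarrow> v = v' \<and> c = c'"
  "evals p env es vs c \<Longrightarrow> evals p env es vs' c' \<Longrightarrow> vs = vs' \<and> c = c'"
proof (induction arbitrary: v' c' and vs' c' rule: eval_evals.inducts)
  case (eval_Var i env)
  from eval_Var.prems show ?case by (rule eval_VarE) simp
next
  case (eval_Null env)
  from eval_Null.prems show ?case by (rule eval_NullE) simp
next
  case (eval_Cell env a v c b w d)
  from eval_Cell.prems show ?case by (rule eval_CellE) (auto dest!: eval_Cell.IH(2,4))
next
  case (eval_Fst env a v c)
  from eval_Fst.prems show ?case by (rule eval_FstE) (auto dest!: eval_Fst.IH(2))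
next
  case (eval_Snd env a v c)
  from eval_Snd.prems show ?case by (rule eval_SndE) (auto dest!: eval_Snd.IH(2))
next
  case (eval_If_True env b v c a1 w d a2)
  from eval_If_True.prems show ?case
    by (rule eval_IfE) (use eval_If_True.hyps in \<open>auto dest!: eval_If_True.IH(2,4)\<close>)
next
  case (eval_If_False env b c a2 w d a1)
  from eval_If_False.prems show ?case by (rule eval_IfE) (auto dest!: eval_If_False.IH(2,4))
next
  case (eval_Let env a v c b w d)
  from eval_Let.prems show ?case by (rule eval_LetE) (auto dest!: eval_Let.IH(2,4))
next
  case (eval_Call f env as vs c w d)
  from eval_Call.prems show ?case by (rule eval_CallE) (auto dest!: eval_Call.IH(3,5))
next
  case (evals_Nil env)
  from evals_Nil.prems show ?case by (rule evals_NilE) simp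
next
  case (evals_Cons env a v c as vs d)
  from evals_Cons.prems show ?case by (rule evals_ConsE) (auto dest!: evals_Cons.IH(2,4))
qed

definition run :: "program \<Rightarrow> val \<Rightarrow> val \<Rightarrow> nat \<Rightarrow> bool" where
  "run p x v c \<longleftrightarrow> eval p [x] (CallE 0 [VarE 0]) v c"

text \<open>
  The output \<open>Null\<close> means ``no'', any other output means ``yes''. Inputs that do not encode an
  instance in \<open>I\<close> are not constrained.
\<close>

definition decides_within ::
  "program \<Rightarrow> 'i set \<Rightarrow> ('i \<Rightarrow> val) \<Rightarrow> ('i \<Rightarrow> bool) \<Rightarrow> ('i \<Rightarrow> nat) \<Rightarrow> bool" where
  "decides_within p I enc yes T \<longleftrightarrow>
     (\<forall>x\<in>I. \<exists>v c. run p (enc x) v c \<and> c \<le> T x \<and> (v \<noteq> Null \<longleftrightarrow> yes x))"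

section \<open>Encodings\<close>

fun enc_list :: "val list \<Rightarrow> val" where
  "enc_list [] = Null"
| "enc_list (x # xs) = Cell x (enc_list xs)"

definition enc_bool :: "bool \<Rightarrow> val" where
  "enc_bool b = (if b then Cell Null Null else Null)"

text \<open>Numbers are written in binary, least significant bit first, without leading zeros.\<close>

fun bits :: "nat \<Rightarrow> bool list" where
  "bits n = (if n = 0 then [] else odd n # bits (n div 2))"

declare bits.simps [simp del]

definition enc_nat :: "nat \<Rightarrow> val" where
  "enc_nat n = enc_list (map enc_bool (bits n))"

text \<open>Graphs are given by their adjacency matrix, with the vertices in increasing order.\<close>

definition enc_graph :: "nat pair_pre_digraph \<Rightarrow> val" where
  "enc_graph G = (let vs = sorted_list_of_set (pverts G) in
     enc_list (map (\<lambda>u. enc_list (map (\<lambda>v. enc_bool ((u, v) \<in> parcs G)) vs)) vs))"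

section \<open>Fixed-parameter tractability\<close>

definition computable :: "(nat \<Rightarrow> nat) \<Rightarrow> bool" where
  "computable f \<longleftrightarrow> (\<exists>p. \<forall>m. \<exists>c. run p (enc_nat m) (enc_nat (f m)) c)"

text \<open>
  A factor \<open>n\<^bsup>O(1)\<^esup>\<close> is written \<open>(n + 1) ^ d\<close>, up to a constant factor, so that it is
  positive for \<open>n = 0\<close> and grows for \<open>n = 1\<close>; constants are absorbed by \<open>f\<close> below.
\<close>

definition fixed_parameter_tractable ::
  "'i set \<Rightarrow> ('i \<Rightarrow> val) \<Rightarrow> ('i \<Rightarrow> nat) \<Rightarrow> ('i \<Rightarrow> nat) \<Rightarrow> ('i \<Rightarrow> bool) \<Rightarrow> bool" where
  "fixed_parameter_tractable I enc n param yes \<longleftrightarrow>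
     (\<exists>p f d. computable f \<and>
        decides_within p I enc yes (\<lambda>x. f (param x) * (n x + 1) ^ d))"

section \<open>Cutting at most k vertices\<close>

text \<open>\<^const>\<open>pair_graph\<close> describes finite simple undirected graphs as symmetric loop-free relations.\<close>

definition open_neighborhood :: "'a pair_pre_digraph \<Rightarrow> 'a set \<Rightarrow> 'a set" where
  "open_neighborhood G U = (\<Union>v\<in>U. {w. (v, w) \<in> parcs G}) - U"

type_synonym cut_instance = "nat pair_pre_digraph \<times> nat \<times> nat"

definition cut_instances :: "cut_instance set" where
  "cut_instances = {(G, k, t). pair_graph G \<and> k \<ge> 1}"

fun enc_cut_instance :: "cut_instance \<Rightarrow> val" where
  "enc_cut_instance (G, k, t) = Cell (enc_graph G) (Cell (enc_nat k) (enc_nat t))"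

fun num_vertices :: "cut_instance \<Rightarrow> nat" where
  "num_vertices (G, k, t) = card (pverts G)"

fun cut_bound :: "cut_instance \<Rightarrow> nat" where
  "cut_bound (G, k, t) = t"

fun cutting_at_most_k_vertices :: "cut_instance \<Rightarrow> bool" where
  "cutting_at_most_k_vertices (G, k, t) \<longleftrightarrow>
     (\<exists>X. X \<noteq> {} \<and> X \<subseteq> pverts G \<and> card X \<le> k \<and> card (open_neighborhood G X) \<le> t)"

end

(*
  Let X be a smallest non-empty set with |N(X)| <= t. A vertex s of X is guessed.

  If |X| <= t, then X is found by growing A = {s}: as long as N(A) is too large, some vertex of N(A)
  is put into A or into a set D of vertices known to lie in N(X). This takes at most 2t binary choices.

  If |X| > t, let T contain D and avoid X, and let Z be the smallest set among those that minimise
  f(Z) = |N(Z) - D| over the sets containing s and avoiding T. By submodularity of f and the choice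
  of X, X is contained in Z. If |Z| + f(Z) <= k + (t - |D|), surplus vertices of Z can be moved to the
  boundary. Otherwise, a vertex w of N(Z) - D lies in N(X), and is added to D and T, or outside N[X],
  and N[w] is added to T, which increases the minimum of f. So 2(t - |D|) - min f decreases in both
  branches, and there are at most 2t binary choices again. If N(Z) - D is empty there is no such w,
  but an uncrossing argument shows that N[v] may be added to T, without branching, for the vertex v
  of Z - N[s] that leads to the smallest minimum of f.

  The minimum of f over sets containing s is the deficiency of a bipartite graph between vertices and
  their closed neighborhoods, and is found by augmenting an assignment.
*)

theory Submission
  imports Defs
begin

section \<open>Boundaries and smallest sets\<close>

text \<open>Minimality of X ranges over all non-empty sets with boundary at most t, regardless of k.
  It forces X into every Y that X meets in a set whose boundary is still at most t, and every use of
  submodularity ends in this one fact. The measure has its form because putting w into D lowers the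
  budget by one but may lower min f by one as well, whereas forbidding N[w] keeps the budget and
  raises min f; the rise is strict only because the cut is the inclusion-least minimiser. When a cut
  has no boundary outside D, the assumption |X| > t is essential: every non-empty part of the cut
  with boundary at most t - |D| then has more than t vertices and cannot fit into a boundary. In the
  machine model, the obstacle is that the time bound does not mention k, while k and t come in
  binary and may be arbitrarily long. They are capped at n by reading at most n digits, which
  changes no answer because |X| and |N(X)| never exceed n.\<close>

locale reflexive_graph =
  fixes n :: nat and R :: "nat \<Rightarrow> nat \<Rightarrow> bool"
  assumes R_refl [simp]: "R u u" and R_sym: "R u v \<Longrightarrow> R v u"
begin

definition cl :: "nat set \<Rightarrow> nat set" where
  "cl X = {v. v < n \<and> (\<exists>u\<in>X. R u v)}"

definition bd :: "nat set \<Rightarrow> nat set \<Rightarrow> nat set" where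
  "bd D X = cl X - X - D"

definition nb :: "nat \<Rightarrow> nat set" where
  "nb u = cl {u}"

lemma nb_iff: "v \<in> nb u \<longleftrightarrow> v < n \<and> R u v"
  by (auto simp: nb_def cl_def)

lemma finite_bd [simp]: "finite (bd D X)" and finite_cl [simp]: "finite (cl X)"
  by (auto simp: bd_def cl_def)

lemma cl_Un: "cl (X \<union> Y) = cl X \<union> cl Y"
  by (auto simp: cl_def)

lemma cl_less: "cl X \<subseteq> {..<n}"
  by (auto simp: cl_def)

lemma bd_less: "bd D X \<subseteq> {..<n}"
  by (auto simp: bd_def cl_def)

lemma subset_cl: "X \<subseteq> {..<n} \<Longrightarrow> X \<subseteq> cl X"
  unfolding cl_def using R_refl by blast

section \<open>Size of the boundary: submodularity and the effect of \<open>D\<close>\<close>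

lemma card_cl_Un:
  assumes "X \<subseteq> {..<n}" "D \<subseteq> {..<n}" "X \<inter> D = {}"
  shows "card (cl X \<union> D) = card (bd D X) + card X + card D"
proof -
  have fin: "finite X" "finite D" using assms finite_subset by blast+
  have "cl X \<union> D = bd D X \<union> (X \<union> D)" using subset_cl[OF assms(1)] by (auto simp: bd_def)
  moreover have "card (bd D X \<union> (X \<union> D)) = card (bd D X) + card (X \<union> D)"
    using fin by (intro card_Un_disjoint) (auto simp: bd_def)
  ultimately show ?thesis using fin assms(3) by (simp add: card_Un_disjoint)
qed

text \<open>By \<open>card_cl_Un\<close>, \<open>card (bd D X)\<close> is the coverage function
  \<open>card (cl X \<union> D)\<close> minus the modular term \<open>card X + card D\<close>.
  Coverage is submodular because \<open>cl\<close> commutes with unions, while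
  \<open>cl (X \<inter> Y)\<close> lies in the intersection of \<open>cl X\<close> and
  \<open>cl Y\<close>.\<close>

lemma submodular:
  assumes "X \<subseteq> {..<n}" "Y \<subseteq> {..<n}" "D \<subseteq> {..<n}" "X \<inter> D = {}" "Y \<inter> D = {}"
  shows "card (bd D (X \<inter> Y)) + card (bd D (X \<union> Y)) \<le> card (bd D X) + card (bd D Y)"
proof -
  have fin: "finite X" "finite Y" "finite D" using assms finite_subset by blast+
  have "card (cl (X \<inter> Y) \<union> D) \<le> card ((cl X \<union> D) \<inter> (cl Y \<union> D))"
    using fin by (intro card_mono) (auto simp: cl_def)
  moreover have "cl (X \<union> Y) \<union> D = (cl X \<union> D) \<union> (cl Y \<union> D)" by (auto simp: cl_Un)
  moreover have "card (cl X \<union> D) + card (cl Y \<union> D) =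
      card ((cl X \<union> D) \<union> (cl Y \<union> D)) + card ((cl X \<union> D) \<inter> (cl Y \<union> D))"
    using fin by (intro card_Un_Int) auto
  moreover have "card X + card Y = card (X \<union> Y) + card (X \<inter> Y)" using fin by (intro card_Un_Int)
  moreover have "card (cl (X \<inter> Y) \<union> D) = card (bd D (X \<inter> Y)) + card (X \<inter> Y) + card D"
    using assms by (intro card_cl_Un) auto
  moreover have "card (cl (X \<union> Y) \<union> D) = card (bd D (X \<union> Y)) + card (X \<union> Y) + card D"
    using assms by (intro card_cl_Un) auto
  ultimately show ?thesis
    using card_cl_Un[OF assms(1,3,4)] card_cl_Un[OF assms(2,3,5)] by simp
qed

lemma card_bd_empty_le: "finite D \<Longrightarrow> card (bd {} X) \<le> card D + card (bd D X)"
proof -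
  assume "finite D"
  then have "card (bd {} X) \<le> card (D \<union> bd D X)" by (intro card_mono) (auto simp: bd_def)
  also have "\<dots> \<le> card D + card (bd D X)" by (rule card_Un_le)
  finally show ?thesis .
qed

lemma bd_empty: "bd {} X = D \<union> bd D X" if "D \<subseteq> bd {} X"
  using that by (auto simp: bd_def)

lemma card_bd_empty: "card (bd {} X) = card D + card (bd D X)" if "D \<subseteq> bd {} X"
proof -
  have "finite D" using that by (rule finite_subset) simp
  moreover have "D \<inter> bd D X = {}" by (auto simp: bd_def)
  ultimately show ?thesis using card_Un_disjoint[of D "bd D X"] by (simp add: bd_empty[OF that])
qed

lemma bd_insert: "bd (insert w D) X = bd D X - {w}"
  by (auto simp: bd_def)

text \<open>Translates between adding \<open>nb w\<close> to the forbidden set \<open>T\<close> and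
  guessing that \<open>w\<close> lies outside the closed neighborhood of the solution; it rests on
  the symmetry of \<open>R\<close>.\<close>

lemma nb_disjoint_iff: "nb w \<inter> X = {} \<longleftrightarrow> w \<notin> cl X" if "X \<subseteq> {..<n}" "w < n"
  using that R_sym unfolding cl_def nb_iff disjoint_iff by blast

section \<open>Solutions and smallest sets\<close>

definition solution :: "nat \<Rightarrow> nat \<Rightarrow> nat set \<Rightarrow> bool" where
  "solution k t X \<longleftrightarrow> X \<noteq> {} \<and> X \<subseteq> {..<n} \<and> card X \<le> k \<and> card (bd {} X) \<le> t"

text \<open>A vertex taken out of a set enlarges the boundary by at most that vertex.\<close>

lemma shrink_solution:
  assumes "X \<noteq> {}" "X \<subseteq> {..<n}" "k \<ge> 1" "card X + card (bd {} X) \<le> k + t" "card (bd {} X) \<le> t"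
  shows "\<exists>Y. solution k t Y"
proof (cases "card X \<le> k")
  case True
  then show ?thesis using assms by (auto simp: solution_def)
next
  case False
  then obtain Y where Y: "Y \<subseteq> X" "card Y = k" "finite Y"
    using obtain_subset_with_card_n[of k X] by auto
  have fX: "finite X" using assms(2) finite_subset by blast
  have "card (bd {} Y) \<le> card (bd {} X \<union> (X - Y))"
    using Y(1) fX by (intro card_mono) (auto simp: bd_def cl_def)
  also have "\<dots> \<le> card (bd {} X) + card (X - Y)" by (rule card_Un_le)
  also have "card (X - Y) = card X - k" using Y by (simp add: card_Diff_subset)
  finally have "card (bd {} Y) \<le> t" using assms(4) False by linarith
  moreover have "Y \<noteq> {}" using Y(2) assms(3) by auto
  ultimately have "solution k t Y" using Y assms(2) by (simp add: solution_def)
  then show ?thesis ..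
qed

definition smallest :: "nat \<Rightarrow> nat set \<Rightarrow> bool" where
  "smallest t X \<longleftrightarrow> X \<noteq> {} \<and> X \<subseteq> {..<n} \<and> card (bd {} X) \<le> t \<and>
     (\<forall>Y. Y \<noteq> {} \<longrightarrow> Y \<subseteq> {..<n} \<longrightarrow> card (bd {} Y) \<le> t \<longrightarrow> card X \<le> card Y)"

lemma ex_smallest:
  assumes "solution k t X0"
  obtains X where "smallest t X" "card X \<le> k"
proof -
  let ?P = "\<lambda>X. X \<noteq> {} \<and> X \<subseteq> {..<n} \<and> card (bd {} X) \<le> t"
  obtain X where X: "?P X" "\<forall>Y. ?P Y \<longrightarrow> card X \<le> card Y"
    using ex_has_least_nat[of ?P X0 card] assms by (auto simp: solution_def)
  show ?thesis
  proof (rule that[of X])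
    show "smallest t X" using X by (simp add: smallest_def)
    have "card X \<le> card X0" using X(2) assms by (simp add: solution_def)
    then show "card X \<le> k" using assms by (simp add: solution_def)
  qed
qed

lemma smallest_le:
  assumes "smallest t X" "finite D" "card D + card (bd D Y) \<le> t" "Y \<noteq> {}" "Y \<subseteq> {..<n}"
  shows "card X \<le> card Y"
  using assms card_bd_empty_le[OF assms(2), of Y] by (auto simp: smallest_def)

text \<open>The intersection competes with \<open>X\<close>, so minimality gives it at least as many
  vertices; being a subset of \<open>X\<close>, it equals \<open>X\<close>.\<close>

lemma smallest_subset:
  assumes "smallest t X" "finite D" "card D + card (bd D (X \<inter> Y)) \<le> t" "X \<inter> Y \<noteq> {}"
  shows "X \<subseteq> Y"
proof -
  have X: "X \<subseteq> {..<n}" using assms by (simp add: smallest_def)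
  then have "finite X" using finite_subset by blast
  moreover have "card X \<le> card (X \<inter> Y)" using X by (intro smallest_le[OF assms(1-4)]) auto
  ultimately have "X \<inter> Y = X" by (intro card_seteq) auto
  then show ?thesis by blast
qed

section \<open>Closest cuts and uncrossing\<close>

definition closest_cut :: "nat \<Rightarrow> nat set \<Rightarrow> nat set \<Rightarrow> nat set \<Rightarrow> bool" where
  "closest_cut s T D X \<longleftrightarrow> s \<in> X \<and> X \<subseteq> {..<n} \<and> X \<inter> T = {} \<and>
     (\<forall>Y. s \<in> Y \<longrightarrow> Y \<subseteq> {..<n} \<longrightarrow> Y \<inter> T = {} \<longrightarrow>
        card (bd D X) \<le> card (bd D Y) \<and> (card (bd D X) = card (bd D Y) \<longrightarrow> X \<subseteq> Y))"

text \<open>\<open>X \<union> Y\<close> still contains \<open>s\<close> and avoids \<open>T\<close>,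
  so its boundary is no smaller than that of \<open>Y\<close>. Submodularity passes this on: the
  boundary of \<open>X \<inter> Y\<close> is no larger than that of \<open>X\<close>.\<close>

lemma smallest_subset_cut:
  assumes X: "smallest t X" and c: "closest_cut s T D Y" and "s \<in> X" "X \<inter> T = {}"
    and D: "D \<subseteq> T" "D \<subseteq> {..<n}" "card D + card (bd D X) \<le> t"
  shows "X \<subseteq> Y"
proof -
  have sub: "X \<subseteq> {..<n}" "Y \<subseteq> {..<n}" "Y \<inter> T = {}" "s \<in> Y"
    using X c by (auto simp: smallest_def closest_cut_def)
  have fD: "finite D" using D finite_subset by blast
  have "card (bd D Y) \<le> card (bd D (X \<union> Y))"
    using c assms(4) sub by (auto simp: closest_cut_def Int_Un_distrib2)
  moreover have "card (bd D (X \<inter> Y)) + card (bd D (X \<union> Y)) \<le> card (bd D X) + card (bd D Y)"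
    using sub assms by (intro submodular) auto
  ultimately have "card D + card (bd D (X \<inter> Y)) \<le> t" using D by linarith
  then show ?thesis using smallest_subset[OF X fD] sub assms(3) by blast
qed

text \<open>\<open>Y'\<close> competes with \<open>Y\<close> but cannot contain it, since
  \<open>w\<close> is in \<open>cl Y\<close> and not in \<open>cl Y'\<close>. A tie would force
  \<open>Y \<subseteq> Y'\<close>, so leastness among the minimisers makes the increase
  strict.\<close>

lemma cut_insert_grows:
  assumes c: "closest_cut s T D Y" and c': "closest_cut s (T \<union> nb w) D Y'"
    and w: "w < n" "w \<in> cl Y"
  shows "card (bd D Y) < card (bd D Y')"
proof -
  have Y': "s \<in> Y'" "Y' \<subseteq> {..<n}" "Y' \<inter> T = {}" "nb w \<inter> Y' = {}"
    using c' by (auto simp: closest_cut_def)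
  have "\<not> Y \<subseteq> Y'"
  proof
    assume "Y \<subseteq> Y'"
    then have "w \<in> cl Y'" using w by (auto simp: cl_def)
    then show False using nb_disjoint_iff[OF Y'(2) w(1)] Y'(4) by blast
  qed
  moreover have "card (bd D Y) \<le> card (bd D Y')"
    "card (bd D Y) = card (bd D Y') \<longrightarrow> Y \<subseteq> Y'"
    using c Y'(1-3) by (auto simp: closest_cut_def)
  ultimately show ?thesis by linarith
qed

text \<open>If \<open>X\<close> dominated \<open>Z\<close>, then \<open>X\<close> and its boundary
  would cover \<open>Z\<close>. This supplies a vertex whose closed neighborhood can be forbidden
  when there is no boundary vertex to branch on.\<close>

lemma Diff_cl_nonempty:
  assumes "X \<subseteq> Z" "Z \<inter> D = {}" "Z \<subseteq> {..<n}" "card X + card (bd D X) < card Z"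
  shows "Z - cl X \<noteq> {}"
proof
  have fX: "finite X" using assms(1,3) by (meson finite_lessThan finite_subset)
  assume "Z - cl X = {}"
  then have "Z \<subseteq> X \<union> bd D X" using assms(2) by (auto simp: bd_def)
  then have "card Z \<le> card (X \<union> bd D X)" using fX by (intro card_mono) auto
  also have "\<dots> \<le> card X + card (bd D X)" by (rule card_Un_le)
  finally show False using assms(4) by linarith
qed

text \<open>
  The case of a cut \<open>Z\<close> with empty boundary. If \<open>X\<close> were not contained in \<open>Y\<close>, then \<open>Y\<close> and
  \<open>Z - cl Y\<close> would both be crossed by \<open>X\<close>, and uncrossing shows that one of \<open>Z - cl Y\<close> and
  \<open>Z - cl X\<close>, which both have more than \<open>t\<close> vertices, is squeezed into a boundary of size at most \<open>t'\<close>.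
\<close>

lemma smallest_subset_best_cut:
  assumes X: "smallest t X" "t < card X" "s \<in> X" "X \<subseteq> Z" "card D + t' \<le> t" "card (bd D X) \<le> t'"
    and Z: "Z \<subseteq> {..<n}" "Z \<inter> D = {}" "bd D Z = {}" "card X + t' < card Z"
    and D: "D \<subseteq> {..<n}"
    and Y: "s \<in> Y" "Y \<subseteq> Z" "v \<in> Z - cl Y"
    and min: "\<And>U. s \<in> U \<Longrightarrow> U \<subseteq> Z \<Longrightarrow> Z - cl U \<noteq> {} \<Longrightarrow> card (bd D Y) \<le> card (bd D U)"
  shows "X \<subseteq> Y"
proof (rule ccontr)
  assume not: "\<not> X \<subseteq> Y"
  have fZ: "finite Z" and fD: "finite D" using Z D finite_subset by blast+
  have Xn: "X \<subseteq> {..<n}" and Yn: "Y \<subseteq> {..<n}" using X(4) Y(2) Z(1) by auto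
  \<comment> \<open>Since \<open>Z\<close> has no boundary outside \<open>D\<close>, a subset of
    \<open>Z\<close> cannot reach beyond \<open>Z\<close> and \<open>D\<close> either.\<close>
  have inZ: "bd D U \<subseteq> Z" if "U \<subseteq> Z" for U
    using that Z(3) by (auto simp: bd_def cl_def)
  have bdZ: "U \<subseteq> Z \<Longrightarrow> bd D U = (cl U - U) \<inter> Z" for U
    using inZ[of U] Z(2) by (auto simp: bd_def)
  \<comment> \<open>The part of \<open>Z\<close> beyond \<open>cl U\<close> is not adjacent to
    \<open>U\<close>, so its boundary consists of boundary vertices of \<open>U\<close>.\<close>
  have opp: "bd D (Z - cl U) \<subseteq> bd D U" if "U \<subseteq> Z" for U
  proof
    fix x assume x: "x \<in> bd D (Z - cl U)"
    then have xZ: "x \<in> Z" using inZ[of "Z - cl U"] by blast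
    from x have "x \<in> cl U" using xZ by (simp add: bd_def)
    moreover have "x \<notin> U"
    proof
      assume "x \<in> U"
      moreover obtain u where "u \<in> Z - cl U" "R u x" using x unfolding bd_def cl_def by blast
      ultimately show False using Z(1) R_sym unfolding cl_def by blast
    qed
    ultimately show "x \<in> bd D U" using xZ bdZ[OF that] by blast
  qed
  have oppc: "card (bd D (Z - cl U)) \<le> card (bd D U)" if "U \<subseteq> Z" for U
    using opp[OF that] by (intro card_mono) auto
  \<comment> \<open>Together with \<open>D\<close>, the boundary of such a \<open>U\<close> stays
    within \<open>t\<close>, so \<open>U\<close> is at least as large as \<open>X\<close>.\<close>
  have big: "t < card U" if "U \<noteq> {}" "U \<subseteq> Z" "card (bd D U) \<le> t'" for U
    using smallest_le[OF X(1) fD, of U] that X(2,5) Z(1) by force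
  have "Z - cl X \<noteq> {}" using X(4,6) Z by (intro Diff_cl_nonempty[of X Z D]) auto
  then have Yt: "card (bd D Y) \<le> t'" using min[OF X(3,4)] X(6) by linarith
  let ?Q = "Z - cl Y"
  have Q: "?Q \<subseteq> Z" "?Q \<subseteq> {..<n}" "?Q \<noteq> {}" "card (bd D ?Q) \<le> card (bd D Y)"
    using Y(2,3) Z(1) oppc[OF Y(2)] by auto
  have Qbig: "t < card ?Q" using big[OF Q(3,1)] Q(4) Yt by linarith
  \<comment> \<open>As \<open>X\<close> is not contained in \<open>U\<close>, the intersection has
    boundary above \<open>t'\<close>, and submodularity pushes \<open>X \<union> U\<close> strictly
    below \<open>Y\<close>. Minimality of \<open>Y\<close> permits this only if
    \<open>X \<union> U\<close> dominates all of \<open>Z\<close>.\<close>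
  have cross: "Z \<subseteq> cl (X \<union> U)" if U: "X \<inter> U \<noteq> {}" "\<not> X \<subseteq> U" "U \<subseteq> Z" "card (bd D U) \<le> card (bd D Y)" for U
  proof (rule ccontr)
    assume *: "\<not> Z \<subseteq> cl (X \<union> U)"
    have "\<not> card D + card (bd D (X \<inter> U)) \<le> t" using smallest_subset[OF X(1) fD _ U(1)] U(2) by blast
    then have "t' < card (bd D (X \<inter> U))" using X(5) by linarith
    moreover have "card (bd D (X \<inter> U)) + card (bd D (X \<union> U)) \<le> card (bd D X) + card (bd D U)"
      using Xn U(3) Z D X(4) by (intro submodular) auto
    moreover have "card (bd D Y) \<le> card (bd D (X \<union> U))" using * U(3) X(3,4) by (intro min) auto
    ultimately show False using X(6) U(4) by linarith
  qed
  have c1: "Z \<subseteq> cl (X \<union> Y)" using X(3) Y not by (intro cross) auto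
  have sQ: "s \<notin> ?Q" using subset_cl[OF Yn] Y(1) by blast
  show False
  proof (cases "X \<inter> ?Q = {}")
    case True
    \<comment> \<open>\<open>?Q\<close> avoids \<open>cl Y\<close> and \<open>X\<close>; being
      dominated by \<open>X \<union> Y\<close>, it must lie in the boundary of
      \<open>X\<close>.\<close>
    have "?Q \<subseteq> bd D X" using c1 True bdZ[OF X(4)] by (auto simp: cl_Un)
    then have "card ?Q \<le> card (bd D X)" by (intro card_mono) auto
    then show False using Qbig X(5,6) by linarith
  next
    case False
    \<comment> \<open>\<open>X\<close> crosses \<open>?Q\<close> as well: it meets \<open>?Q\<close>
      and contains \<open>s\<close>, which \<open>?Q\<close> does not. So the vertices of
      \<open>Z - cl X\<close> are dominated by both \<open>Y\<close> and \<open>?Q\<close>. No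
      vertex of \<open>Y\<close> is adjacent to \<open>?Q\<close>, which leaves only the boundary of
      \<open>Y\<close>.\<close>
    have c2: "Z \<subseteq> cl (X \<union> ?Q)" using False sQ X(3) Q by (intro cross) auto
    let ?S = "Z - cl X"
    have "?S \<subseteq> bd D Y"
    proof
      fix x assume x: "x \<in> ?S"
      then have "x \<in> cl Y" "x \<in> cl ?Q" using c1 c2 by (auto simp: cl_Un)
      moreover have "x \<notin> Y"
      proof
        assume "x \<in> Y"
        moreover obtain u where "u \<in> ?Q" "R u x" using \<open>x \<in> cl ?Q\<close> unfolding cl_def by blast
        ultimately show False using Z(1) R_sym unfolding cl_def by blast
      qed
      ultimately show "x \<in> bd D Y" using x bdZ[OF Y(2)] by blast
    qed
    then have "card ?S \<le> card (bd D Y)" by (intro card_mono) auto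
    moreover have "t < card ?S" using oppc[OF X(4)] X(6) \<open>Z - cl X \<noteq> {}\<close> by (intro big) auto
    ultimately show False using Yt X(5) by linarith
  qed
qed

end

section \<open>Branching\<close>

lemma fold_min:
  fixes F :: "'a \<Rightarrow> nat" and P :: "'a \<Rightarrow> bool"
  defines "g \<equiv> \<lambda>v a. if P v \<and> F v < fst a then (F v, v) else a"
  shows "fst (fold g xs a) \<le> fst a \<and>
    (fold g xs a = a \<or> (\<exists>v\<in>set xs. P v \<and> fold g xs a = (F v, v))) \<and>
    (\<forall>v\<in>set xs. P v \<longrightarrow> fst (fold g xs a) \<le> F v)"
proof (induction xs arbitrary: a)
  case (Cons x xs)
  have "fst (g x a) \<le> fst a" "P x \<longrightarrow> fst (g x a) \<le> F x" "g x a = a \<or> P x \<and> g x a = (F x, x)"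
    by (auto simp: g_def)
  then show ?case using Cons[of "g x a"] by (auto intro: order_trans)
qed simp

text \<open>The branching argument sees closest cuts only through their specification; the
  augmentation algorithm is plugged in later by a sublocale.\<close>

locale graph_with_cuts = reflexive_graph +
  fixes cut :: "nat \<Rightarrow> nat set \<Rightarrow> nat set \<Rightarrow> nat set"
  assumes cut: "s < n \<Longrightarrow> T \<subseteq> {..<n} \<Longrightarrow> s \<notin> T \<Longrightarrow> D \<subseteq> T \<Longrightarrow> closest_cut s T D (cut s T D)"
begin

definition cut_size :: "nat \<Rightarrow> nat set \<Rightarrow> nat set \<Rightarrow> nat" where
  "cut_size s T D = card (bd D (cut s T D))"

definition best_step :: "nat \<Rightarrow> nat set \<Rightarrow> nat set \<Rightarrow> nat set \<Rightarrow> nat \<Rightarrow> nat \<times> nat \<Rightarrow> nat \<times> nat" where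
  "best_step s T D Z v a =
     (if (v \<in> Z \<and> \<not> R s v) \<and> cut_size s (T \<union> nb v) D < fst a then (cut_size s (T \<union> nb v) D, v) else a)"

text \<open>The start value \<open>Suc n\<close> exceeds every \<open>cut_size\<close>. It survives
  exactly if no vertex is eligible, and then fails the test against a budget of at most
  \<open>n\<close>. The order is decreasing because the program builds its vertex list that
  way.\<close>

definition best :: "nat \<Rightarrow> nat set \<Rightarrow> nat set \<Rightarrow> nat set \<Rightarrow> nat \<times> nat" where
  "best s T D Z = fold (best_step s T D Z) (rev [0..<n]) (Suc n, s)"

text \<open>The second argument limits the depth, and exhausting it counts as failure;
  \<open>t\<close> is what remains of the budget after paying for \<open>D\<close>. The guard
  \<open>R s w\<close> is there because a set containing \<open>s\<close> cannot avoid
  \<open>nb w\<close> if \<open>w\<close> is adjacent to \<open>s\<close>.\<close>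

primrec solve :: "nat \<Rightarrow> nat \<Rightarrow> nat \<Rightarrow> nat set \<Rightarrow> nat set \<Rightarrow> nat \<Rightarrow> bool" where
  "solve k 0 s T D t = False"
| "solve k (Suc m) s T D t =
    (let X = cut s T D; B = bd D X; l = card B in
     if t < l then False
     else if card X + l \<le> k + t then True
     else if l = 0 then
       (let a = best s T D X in
        if fst a \<le> t then solve k m s (T \<union> nb (snd a)) D t else False)
     else
       (let w = LEAST w. w \<in> B in
        solve k m s (insert w T) (insert w D) (t - 1) \<or>
        (\<not> R s w \<and> solve k m s (T \<union> nb w) D t)))"

primrec enum :: "nat \<Rightarrow> nat \<Rightarrow> nat set \<Rightarrow> nat set \<Rightarrow> nat \<Rightarrow> bool" where
  "enum k 0 A D t = False"
| "enum k (Suc m) A D t =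
    (let B = bd D A in
     if card B \<le> t then card A \<le> k
     else
       (let w = LEAST w. w \<in> B in
        enum k m (insert w A) D t \<or> (0 < t \<and> enum k m A (insert w D) (t - 1))))"

declare solve.simps(2) [simp del] enum.simps(2) [simp del]

text \<open>Beyond the \<open>2 * t\<close> binary choices, the extra unit of depth pays for the
  last call, which answers without recursing.\<close>

definition decide :: "nat \<Rightarrow> nat \<Rightarrow> bool" where
  "decide k t \<longleftrightarrow> (\<exists>s<n. enum k (Suc (t + t)) {s} {} t \<or> solve k (Suc (t + t)) s {} {} t)"

section \<open>Soundness and completeness of the two searches\<close>

lemma best:
  obtains "best s T D Z = (Suc n, s)" "\<And>v. v \<in> Z \<Longrightarrow> v < n \<Longrightarrow> R s v"
  | v where "v \<in> Z" "v < n" "\<not> R s v" "best s T D Z = (cut_size s (T \<union> nb v) D, v)"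
    "\<And>u. u \<in> Z \<Longrightarrow> u < n \<Longrightarrow> \<not> R s u \<Longrightarrow> cut_size s (T \<union> nb v) D \<le> cut_size s (T \<union> nb u) D"
proof -
  note fm = fold_min[of "\<lambda>v. v \<in> Z \<and> \<not> R s v" "\<lambda>v. cut_size s (T \<union> nb v) D" "rev [0..<n]" "(Suc n, s)",
      folded best_step_def, folded best_def]
  have le: "cut_size s T D \<le> n" for T
    using card_mono[OF _ bd_less[of D "cut s T D"]] by (simp add: cut_size_def)
  show ?thesis
  proof (cases "best s T D Z = (Suc n, s)")
    case True
    then have "R s v" if "v \<in> Z" "v < n" for v
      using that fm le[of "T \<union> nb v"] by (force simp del: fold_simps)
    then show ?thesis using that(1) True by blast
  next
    case False
    then show ?thesis using fm that(2) by (auto simp del: fold_simps)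
  qed
qed

lemma closest_cutD:
  assumes "closest_cut s T D X" "s \<in> Y" "Y \<subseteq> {..<n}" "Y \<inter> T = {}"
  shows "card (bd D X) \<le> card (bd D Y)" "card (bd D X) = card (bd D Y) \<longrightarrow> X \<subseteq> Y"
  using assms by (simp_all add: closest_cut_def)

lemma card_bd_insert: "card (bd D X) \<le> Suc (card (bd (insert w D) X))"
  unfolding bd_insert using card_Suc_Diff1[of "bd D X" w] by (cases "w \<in> bd D X") auto

lemma Least_in: "card B > 0 \<Longrightarrow> (LEAST w. w \<in> B) \<in> (B :: nat set)"
  by (metis LeastI card.empty ex_in_conv less_numeral_extra(3))

text \<open>A positive answer does not depend on correct guesses: an accepted cut has boundary at
  most \<open>card D + t'\<close> in the whole graph and can be shrunk to a solution, however
  \<open>T\<close> and \<open>D\<close> arose.\<close>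

lemma solve_sound:
  assumes "solve k m s T D t'" "s < n" "T \<subseteq> {..<n}" "s \<notin> T" "D \<subseteq> T" "card D + t' \<le> t" "t \<le> n" "k \<ge> 1"
  shows "\<exists>Y. solution k t Y"
  using assms
proof (induction m arbitrary: T D t')
  case (Suc m)
  have fD: "finite D" using Suc.prems by (intro finite_subset[of D "{..<n}"]) auto
  let ?X = "cut s T D" let ?B = "bd D ?X" let ?w = "LEAST w. w \<in> ?B"
  have c: "closest_cut s T D ?X" using Suc.prems by (intro cut) auto
  have X: "?X \<noteq> {}" "?X \<subseteq> {..<n}" using c by (auto simp: closest_cut_def)
  show ?case
  proof (cases "card ?B \<le> t' \<and> card ?X + card ?B \<le> k + t'")
    case True
    then show ?thesis using card_bd_empty_le[OF fD, of ?X] Suc.prems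
      by (intro shrink_solution[OF X]) auto
  next
    case no: False
    show ?thesis
    proof (cases "card ?B = 0")
      case True
      let ?a = "best s T D ?X"
      have a: "solve k m s (T \<union> nb (snd ?a)) D t'" "fst ?a \<le> t'"
        using Suc.prems(1) no True by (auto simp: solve.simps(2) Let_def split: if_splits)
      \<comment> \<open>The budget excludes the default \<open>(Suc n, s)\<close>, so the chosen
        vertex is a genuine candidate and not adjacent to \<open>s\<close>.\<close>
      then have "fst ?a \<le> n" using Suc.prems by linarith
      then have "\<not> R s (snd ?a)" by (rule_tac best[of s T D ?X]) auto
      then have "s \<notin> T \<union> nb (snd ?a)" using Suc.prems R_sym by (auto simp: nb_iff)
      then show ?thesis using Suc.prems a(1) by (intro Suc.IH[of "T \<union> nb (snd ?a)" D t']) (auto simp: nb_iff)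
    next
      case False
      then have w: "?w \<in> ?B" by (intro Least_in) auto
      then have wD: "?w < n" "?w \<notin> D" "?w \<notin> ?X" by (auto simp: bd_def cl_def)
      have le: "card ?B \<le> t'" "0 < t'" using Suc.prems(1) False by (auto simp: solve.simps(2) Let_def split: if_splits)
      have "s \<in> ?X" using c by (simp add: closest_cut_def)
      then have "s \<noteq> ?w" using wD by metis
      consider "solve k m s (insert ?w T) (insert ?w D) (t' - 1)"
        | "\<not> R s ?w" "solve k m s (T \<union> nb ?w) D t'"
        using Suc.prems(1) no False by (auto simp: solve.simps(2) Let_def split: if_splits)
      then show ?thesis
      proof cases
        case 1
        then show ?thesis using Suc.prems wD fD \<open>s \<noteq> ?w\<close> False le
          by (intro Suc.IH[of "insert ?w T" "insert ?w D" "t' - 1"]) auto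
      next
        case 2
        then have "s \<notin> T \<union> nb ?w" using Suc.prems R_sym by (auto simp: nb_iff)
        then show ?thesis using 2 Suc.prems by (intro Suc.IH[of "T \<union> nb ?w" D t']) (auto simp: nb_iff)
      qed
    qed
  qed
qed simp

text \<open>The last premise says that the depth exceeds \<open>2 * t' - cut_size s T D\<close>. It
  is contradictory at depth 0, because \<open>X\<close> competes with the cut and bounds its size by
  \<open>t'\<close>.\<close>

lemma solve_complete:
  assumes X: "smallest t X" "t < card X" "card X \<le> k" "s \<in> X"
    and "X \<inter> T = {}" "T \<subseteq> {..<n}" "D \<subseteq> T" "D \<subseteq> bd {} X" "card D + t' = t"
    and "2 * t' < cut_size s T D + m"
  shows "solve k m s T D t'"
  using assms(5-)
proof (induction m arbitrary: T D t')
  case 0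
  have sn: "s < n" "s \<notin> T" "X \<subseteq> {..<n}" using X 0 by (auto simp: smallest_def)
  have "closest_cut s T D (cut s T D)" using sn 0 by (intro cut) auto
  then have "cut_size s T D \<le> card (bd D X)" using sn X(4) 0 by (auto simp: closest_cut_def cut_size_def)
  moreover have "card D + card (bd D X) \<le> t"
    using card_bd_empty[OF 0(4)] X(1) by (simp add: smallest_def)
  ultimately show ?case using 0(5,6) by linarith
next
  case (Suc m)
  have sn: "s < n" "s \<notin> T" "X \<subseteq> {..<n}" using X Suc.prems by (auto simp: smallest_def)
  have fD: "finite D" using Suc.prems by (intro finite_subset[of D "{..<n}"]) auto
  let ?X = "cut s T D" let ?B = "bd D ?X" let ?w = "LEAST w. w \<in> ?B"
  have c: "closest_cut s T D ?X" using sn Suc.prems by (intro cut) auto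
  have X0: "s \<in> ?X" "?X \<subseteq> {..<n}" "?X \<inter> T = {}" using c by (auto simp: closest_cut_def)
  have "card D + card (bd D X) \<le> t"
    using card_bd_empty[OF Suc.prems(4)] X(1) by (simp add: smallest_def)
  then have ft: "card (bd D X) \<le> t'" using Suc.prems by linarith
  have le: "card ?B \<le> t'"
  proof -
    have "card ?B \<le> card (bd D X)" using c sn X(4) Suc.prems by (auto simp: closest_cut_def)
    then show ?thesis using ft by linarith
  qed
  have sub: "X \<subseteq> ?X" using Suc.prems ft by (intro smallest_subset_cut[OF X(1) c X(4)]) auto
  show ?case
  proof (cases "card ?X + card ?B \<le> k + t'")
    case True
    then show ?thesis using le by (simp add: solve.simps(2) Let_def)
  next
    case big: False
    show ?thesis
    proof (cases "card ?B = 0")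
      case True
      then have B0: "?B = {}" by simp
      have cZ: "card X + t' < card ?X" using big True X(3) by linarith
      \<comment> \<open>A set \<open>U\<close> that leaves a vertex \<open>v\<close> of the cut
        undominated competes in the cut for \<open>T \<union> nb v\<close>. Hence the best vertex
        attains a minimum over all such \<open>U\<close>, which is the minimality required for
        uncrossing.\<close>
      have cand: "\<exists>v. v \<in> ?X \<and> v < n \<and> \<not> R s v \<and> cut_size s (T \<union> nb v) D \<le> card (bd D U)"
        if U: "s \<in> U" "U \<subseteq> ?X" "?X - cl U \<noteq> {}" for U
      proof -
        obtain v where v: "v \<in> ?X" "v \<notin> cl U" using U(3) by blast
        have vn: "v < n" using v X0 by auto
        have nR: "\<not> R s v" using v U(1) vn by (auto simp: cl_def)
        have "closest_cut s (T \<union> nb v) D (cut s (T \<union> nb v) D)"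
          using sn Suc.prems nR R_sym by (intro cut) (auto simp: nb_iff)
        moreover have "U \<inter> (T \<union> nb v) = {}" using nb_disjoint_iff[of U v] U X0 v vn by blast
        moreover have "U \<subseteq> {..<n}" using U X0 by blast
        ultimately have "cut_size s (T \<union> nb v) D \<le> card (bd D U)"
          using U(1) by (simp add: closest_cut_def cut_size_def)
        then show ?thesis using v vn nR by blast
      qed
      have "?X - cl X \<noteq> {}" using sub X0 Suc.prems cZ ft by (intro Diff_cl_nonempty[of X ?X D]) auto
      then obtain u where u: "u \<in> ?X" "u < n" "\<not> R s u" "cut_size s (T \<union> nb u) D \<le> card (bd D X)"
        using cand[OF X(4) sub] by blast
      obtain v where v: "v \<in> ?X" "v < n" "\<not> R s v" "best s T D ?X = (cut_size s (T \<union> nb v) D, v)"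
        and min: "\<And>u. u \<in> ?X \<Longrightarrow> u < n \<Longrightarrow> \<not> R s u \<Longrightarrow> cut_size s (T \<union> nb v) D \<le> cut_size s (T \<union> nb u) D"
        using u by (rule_tac best[of s T D ?X]) auto
      let ?Y = "cut s (T \<union> nb v) D"
      have c': "closest_cut s (T \<union> nb v) D ?Y"
        using sn Suc.prems v R_sym by (intro cut) (auto simp: nb_iff)
      have Y: "s \<in> ?Y" "?Y \<subseteq> {..<n}" "?Y \<inter> (T \<union> nb v) = {}" using c' by (auto simp: closest_cut_def)
      \<comment> \<open>The old cut has boundary size 0, so intersecting with it costs nothing, and
        leastness of \<open>?Y\<close> keeps it inside.\<close>
      have YX: "?Y \<subseteq> ?X"
      proof -
        have "card (bd D (?Y \<inter> ?X)) + card (bd D (?Y \<union> ?X)) \<le> card (bd D ?Y) + card ?B"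
          using Y X0 Suc.prems by (intro submodular) auto
        then have *: "card (bd D (?Y \<inter> ?X)) \<le> card (bd D ?Y)" using True by linarith
        have yx: "s \<in> ?Y \<inter> ?X" "?Y \<inter> ?X \<subseteq> {..<n}" "(?Y \<inter> ?X) \<inter> (T \<union> nb v) = {}" using Y X0 by auto
        from * closest_cutD[OF c' yx] have "?Y \<subseteq> ?Y \<inter> ?X" by linarith
        then show ?thesis by blast
      qed
      have vY: "v \<notin> cl ?Y" using nb_disjoint_iff[OF Y(2) v(2)] Y(3) by blast
      have XY: "X \<subseteq> ?Y"
      proof (rule smallest_subset_best_cut[OF X(1,2,4) sub _ ft X0(2) _ B0 cZ])
        show "card D + t' \<le> t" "?X \<inter> D = {}" "D \<subseteq> {..<n}" using Suc.prems X0 by auto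
        show "s \<in> ?Y" "?Y \<subseteq> ?X" "v \<in> ?X - cl ?Y" using Y YX v vY by auto
        show "card (bd D ?Y) \<le> card (bd D U)" if "s \<in> U" "U \<subseteq> ?X" "?X - cl U \<noteq> {}" for U
          using cand[OF that] min unfolding cut_size_def by (meson order_trans)
      qed
      \<comment> \<open>\<open>v\<close> lies in the old cut, so forbidding its closed neighborhood
        raises the minimum: the step pays for its depth without branching.\<close>
      have "card ?B < card (bd D ?Y)"
        using v subset_cl[OF X0(2)] by (intro cut_insert_grows[OF c c' v(2)]) auto
      then have "solve k m s (T \<union> nb v) D t'"
        using XY Y Suc.prems by (intro Suc.IH) (auto simp: nb_iff cut_size_def)
      moreover have "cut_size s (T \<union> nb v) D \<le> t'" using min[OF u(1-3)] u(4) ft by linarith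
      ultimately show ?thesis using True v(4) by (simp add: solve.simps(2) Let_def)
    next
      case False
      then have w: "?w \<in> ?B" by (intro Least_in) auto
      then have wD: "?w < n" "?w \<notin> D" "?w \<notin> ?X" "?w \<in> cl ?X" by (auto simp: bd_def cl_def)
      have "solve k m s (insert ?w T) (insert ?w D) (t' - 1) \<or> (\<not> R s ?w \<and> solve k m s (T \<union> nb ?w) D t')"
      proof (cases "?w \<in> bd {} X")
        case True
        let ?Y = "cut s (insert ?w T) (insert ?w D)"
        have c': "closest_cut s (insert ?w T) (insert ?w D) ?Y"
          using sn Suc.prems wD X0(1) by (intro cut) auto
        \<comment> \<open>Forbidding \<open>w\<close> cannot lower the minimum, and moving it to
          \<open>D\<close> lowers it by at most one, while \<open>2 * t'\<close> drops by
          two.\<close>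
        have "card ?B \<le> card (bd D ?Y)" using c c' by (auto simp: closest_cut_def)
        moreover have "card (bd D ?Y) \<le> Suc (card (bd (insert ?w D) ?Y))"
          by (rule card_bd_insert)
        moreover have "2 * t' < card ?B + Suc m" using Suc.prems by (simp add: cut_size_def)
        ultimately have "2 * (t' - 1) < cut_size s (insert ?w T) (insert ?w D) + m"
          using False le unfolding cut_size_def by linarith
        moreover have "?w \<notin> X" using True by (simp add: bd_def)
        moreover have "card (insert ?w D) + (t' - 1) = t"
          using Suc.prems(5) wD fD False le by (subst card_insert_disjoint) linarith+
        ultimately have "solve k m s (insert ?w T) (insert ?w D) (t' - 1)"
          using Suc.prems True wD by (intro Suc.IH) auto
        then show ?thesis ..
      next
        case no: False
        \<comment> \<open>\<open>w\<close> is outside the cut and therefore outside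
          \<open>X\<close>; as it is not a boundary vertex of \<open>X\<close> either, it is outside
          \<open>cl X\<close>.\<close>
        have wX: "?w \<notin> cl X" using no wD sub by (auto simp: bd_def)
        have nR: "\<not> R s ?w" using wX X(4) wD(1) by (auto simp: cl_def)
        have c': "closest_cut s (T \<union> nb ?w) D (cut s (T \<union> nb ?w) D)"
          using sn Suc.prems nR R_sym by (intro cut) (auto simp: nb_iff)
        have "card ?B < card (bd D (cut s (T \<union> nb ?w) D))"
          by (rule cut_insert_grows[OF c c' wD(1,4)])
        then have "solve k m s (T \<union> nb ?w) D t'"
          using nb_disjoint_iff[OF sn(3) wD(1)] wX Suc.prems
          by (intro Suc.IH) (auto simp: nb_iff cut_size_def)
        then show ?thesis using nR by blast
      qed
      then show ?thesis using le big False by (simp add: solve.simps(2) Let_def)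
    qed
  qed
qed

lemma enum_sound:
  assumes "enum k m A D t'" "A \<noteq> {}" "A \<subseteq> {..<n}" "finite D" "card D + t' \<le> t"
  shows "\<exists>Y. solution k t Y"
  using assms
proof (induction m arbitrary: A D t')
  case (Suc m)
  let ?B = "bd D A" let ?w = "LEAST w. w \<in> ?B"
  show ?case
  proof (cases "card ?B \<le> t'")
    case True
    then have "solution k t A"
      using Suc.prems card_bd_empty_le[OF Suc.prems(4), of A]
      by (simp add: solution_def enum.simps(2) Let_def)
    then show ?thesis ..
  next
    case False
    then have w: "?w \<in> ?B" by (intro Least_in) auto
    then have wn: "?w < n" "?w \<notin> D" by (auto simp: bd_def cl_def)
    consider "enum k m (insert ?w A) D t'" | "0 < t'" "enum k m A (insert ?w D) (t' - 1)"
      using Suc.prems(1) False by (auto simp: enum.simps(2) Let_def)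
    then show ?thesis
    proof cases
      case 1
      then show ?thesis using Suc.prems wn by (intro Suc.IH[of "insert ?w A" D t']) auto
    next
      case 2
      then show ?thesis using Suc.prems wn by (intro Suc.IH[of A "insert ?w D" "t' - 1"]) auto
    qed
  qed
qed simp

text \<open>Each step that follows \<open>X\<close> adds a vertex of \<open>X\<close> to
  \<open>A\<close> or spends a unit of \<open>t'\<close>, so \<open>(card X - card A) + t'\<close>
  bounds the number of steps left. Stopping early does no harm, since \<open>A\<close> is never
  larger than \<open>X\<close>.\<close>

lemma enum_complete:
  assumes X: "smallest t X" "card X \<le> k"
    and "A \<subseteq> X" "D \<subseteq> bd {} X" "card D + t' = t" "card X + t' < card A + m"
  shows "enum k m A D t'"
  using assms(3-)
proof (induction m arbitrary: A D t')
  case 0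
  have "finite X" using X by (intro finite_subset[of X "{..<n}"]) (auto simp: smallest_def)
  then have "card A \<le> card X" using 0 by (intro card_mono)
  then show ?case using 0 by linarith
next
  case (Suc m)
  let ?B = "bd D A" let ?w = "LEAST w. w \<in> ?B"
  have fX: "finite X" using X by (intro finite_subset[of X "{..<n}"]) (auto simp: smallest_def)
  have fD: "finite D" using Suc.prems(2) by (rule finite_subset) simp
  have fA: "finite A" using Suc.prems(1) fX by (rule finite_subset)
  show ?case
  proof (cases "card ?B \<le> t'")
    case True
    then show ?thesis using card_mono[OF fX Suc.prems(1)] X(2) by (simp add: enum.simps(2) Let_def)
  next
    case False
    then have w: "?w \<in> ?B" by (intro Least_in) auto
    then have wn: "?w \<in> cl X" "?w \<notin> D" "?w \<notin> A" using Suc.prems(1) by (auto simp: bd_def cl_def)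
    have "enum k m (insert ?w A) D t' \<or> (0 < t' \<and> enum k m A (insert ?w D) (t' - 1))"
    proof (cases "?w \<in> X")
      case True
      then have "enum k m (insert ?w A) D t'" using Suc.prems wn fA by (intro Suc.IH) auto
      then show ?thesis ..
    next
      case False
      then have wb: "?w \<in> bd {} X" using wn by (simp add: bd_def)
      \<comment> \<open>\<open>D\<close> and \<open>w\<close> together lie in a boundary of size at
        most \<open>t\<close>, so the budget is not spent yet.\<close>
      have "card (insert ?w D) \<le> card (bd {} X)" using wb Suc.prems by (intro card_mono) auto
      also have "\<dots> \<le> t" using X by (simp add: smallest_def)
      finally have "0 < t'" using Suc.prems wn fD by simp
      moreover have "enum k m A (insert ?w D) (t' - 1)"
        using Suc.prems wn wb fD \<open>0 < t'\<close> by (intro Suc.IH) auto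
      ultimately show ?thesis by blast
    qed
    then show ?thesis using False by (simp add: enum.simps(2) Let_def)
  qed
qed

theorem decide_iff:
  assumes "t \<le> n" "k \<ge> 1"
  shows "decide k t \<longleftrightarrow> (\<exists>Y. solution k t Y)"
proof
  assume "decide k t"
  then obtain s where s: "s < n" "enum k (Suc (t + t)) {s} {} t \<or> solve k (Suc (t + t)) s {} {} t"
    by (auto simp: decide_def)
  then show "\<exists>Y. solution k t Y"
    using enum_sound[of k "Suc (t + t)" "{s}" "{}" t t] solve_sound[of k "Suc (t + t)" s "{}" "{}" t t] assms
    by auto
next
  assume "\<exists>Y. solution k t Y"
  then obtain X where X: "smallest t X" "card X \<le> k" using ex_smallest by blast
  then obtain s where s: "s \<in> X" "s < n" by (auto simp: smallest_def)
  have "enum k (Suc (t + t)) {s} {} t \<or> solve k (Suc (t + t)) s {} {} t"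
  proof (cases "card X \<le> t")
    case True
    then show ?thesis using s by (intro disjI1 enum_complete[OF X]) auto
  next
    case False
    then show ?thesis using s X by (intro disjI2 solve_complete[OF X(1) _ X(2)]) auto
  qed
  then show "decide k t" using s by (auto simp: decide_def)
qed

end

section \<open>Closest cuts\<close>

text \<open>Every step that changes something raises a measure bounded by \<open>b\<close>, so
  \<open>k\<close> steps use up all the room; an element once fixed stays fixed.\<close>

lemma iterate_fixpoint:
  fixes \<mu> :: "'a \<Rightarrow> nat"
  assumes step: "\<And>x. I x \<Longrightarrow> I (f x) \<and> (f x = x \<or> \<mu> x < \<mu> (f x)) \<and> \<mu> x \<le> b"
    and "I x" "b \<le> \<mu> x + k"
  shows "f ((f ^^ k) x) = (f ^^ k) x" "I ((f ^^ k) x)"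
proof -
  have inv: "I ((f ^^ j) x)" for j by (induction j) (use assms in auto)
  have "f ((f ^^ j) x) = (f ^^ j) x \<or> \<mu> x + Suc j \<le> \<mu> (f ((f ^^ j) x))" for j
  proof (induction j)
    case 0
    then show ?case using step[OF \<open>I x\<close>] by auto
  next
    case (Suc j)
    then show ?case using step[OF inv[of "Suc j"]] by auto
  qed
  from this[of k] show "f ((f ^^ k) x) = (f ^^ k) x"
    using step[OF inv[of "Suc k"]] assms(3) by auto
  show "I ((f ^^ k) x)" by (rule inv)
qed

context reflexive_graph
begin

text \<open>
  The closest cut is found by augmentation. A list \<open>M\<close> assigns an owner \<open>M ! v\<close> to every vertex
  \<open>v\<close>, where the owner \<open>n\<close> means that \<open>v\<close> is free: each vertex outside \<open>T\<close> other than \<open>s\<close> owns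
  exactly one vertex of its closed neighborhood, and \<open>s\<close> owns the vertices of \<open>D\<close> and as many
  others as possible. In the table \<open>W\<close>, the entry \<open>Some M'\<close> at \<open>u\<close> says that \<open>u\<close> can release
  its vertex in favour of \<open>s\<close>, with the resulting assignment \<open>M'\<close>.
\<close>

definition inner_step :: "nat list \<Rightarrow> nat \<Rightarrow> nat list \<Rightarrow> nat \<Rightarrow> nat list option list \<Rightarrow> nat list option list" where
  "inner_step M u M' v W =
     (if W ! (M ! v) = None \<and> R u v then W[M ! v := Some (M'[v := u])] else W)"

definition outer_step :: "nat list \<Rightarrow> nat \<Rightarrow> nat list option list \<Rightarrow> nat list option list" where
  "outer_step M u W =
     (case W ! u of None \<Rightarrow> W | Some M' \<Rightarrow> fold (inner_step M u M') (rev [0..<n]) W)"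

definition round :: "nat list \<Rightarrow> nat list option list \<Rightarrow> nat list option list" where
  "round M W = fold (outer_step M) (rev [0..<n]) W"

text \<open>A search along alternating paths that stores the modified assignments instead of the
  paths. \<open>n\<close> rounds suffice: \<open>s\<close> is present at the start, there are
  \<open>n + 1\<close> owners counting \<open>n\<close>, and each round before stabilisation adds
  one.\<close>

definition reach :: "nat \<Rightarrow> nat list \<Rightarrow> nat list option list" where
  "reach s M = (round M ^^ n) ((replicate (Suc n) None)[s := Some M])"

definition augment :: "nat \<Rightarrow> nat list \<Rightarrow> nat list" where
  "augment s M = (case reach s M ! n of None \<Rightarrow> M | Some M' \<Rightarrow> M')"

text \<open>Reflexivity lets each vertex outside \<open>T\<close> own itself, which makes the start
  perfect; just the vertices of \<open>T\<close> outside \<open>D\<close> are free.\<close>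

definition init_owner :: "nat \<Rightarrow> nat set \<Rightarrow> nat set \<Rightarrow> nat \<Rightarrow> nat" where
  "init_owner s T D v = (if v \<in> D then s else if v \<in> T then n else v)"

definition max_assignment :: "nat \<Rightarrow> nat set \<Rightarrow> nat set \<Rightarrow> nat list" where
  "max_assignment s T D = (augment s ^^ n) (map (init_owner s T D) [0..<n])"

definition cut_of :: "nat list option list \<Rightarrow> nat set" where
  "cut_of W = {v. v < n \<and> W ! v \<noteq> None}"

definition cut :: "nat \<Rightarrow> nat set \<Rightarrow> nat set \<Rightarrow> nat set" where
  "cut s T D = cut_of (reach s (max_assignment s T D))"

section \<open>The reachability table and its invariant\<close>

definition keys :: "nat list option list \<Rightarrow> nat set" where
  "keys W = {u. u \<le> n \<and> W ! u \<noteq> None}"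

definition owned :: "nat list \<Rightarrow> nat \<Rightarrow> nat" where
  "owned M x = card {v. v < n \<and> M ! v = x}"

text \<open>\<open>s\<close> owns \<open>D\<close> without having to be adjacent to it, which
  matches the uniform term \<open>D\<close> in \<open>cl X \<union> D\<close>.\<close>

definition assignment :: "nat \<Rightarrow> nat set \<Rightarrow> nat set \<Rightarrow> nat list \<Rightarrow> bool" where
  "assignment s T D M \<longleftrightarrow> length M = n \<and>
     (\<forall>v<n. if v \<in> D then M ! v = s else M ! v = n \<or> M ! v < n \<and> M ! v \<notin> T \<and> R (M ! v) v)"

lemma assignmentD:
  assumes "assignment s T D M" "v < n" "v \<notin> D"
  shows "M ! v = n \<or> M ! v < n \<and> M ! v \<notin> T \<and> R (M ! v) v"
  using assms unfolding assignment_def by presburger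

text \<open>The clause over \<open>Y\<close> makes the reached owners least among the sets that
  contain \<open>s\<close> and are closed under passing to owners of neighbors. \<open>M'\<close>
  may differ from \<open>M\<close> only where the owner is already reached, so an unreached owner
  still has its vertices to give up. The last count says that \<open>s\<close> gained a vertex and
  \<open>u\<close> lost one.\<close>

definition reach_inv :: "nat \<Rightarrow> nat set \<Rightarrow> nat set \<Rightarrow> nat list \<Rightarrow> nat list option list \<Rightarrow> bool" where
  "reach_inv s T D M W \<longleftrightarrow> length W = Suc n \<and> s \<in> keys W \<and> keys W \<inter> T = {} \<and>
     (\<forall>Y. s \<in> Y \<longrightarrow> (\<forall>u\<in>Y. \<forall>v<n. R u v \<longrightarrow> M ! v \<in> Y) \<longrightarrow> keys W \<subseteq> Y) \<and>
     (\<forall>u M'. u \<le> n \<longrightarrow> W ! u = Some M' \<longrightarrow> assignment s T D M' \<and>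
        (\<forall>v<n. M' ! v = M ! v \<or> M ! v \<in> keys W) \<and>
        (\<forall>x. owned M' x + of_bool (x = u) = owned M x + of_bool (x = s)))"

lemma owned_update:
  assumes "length M = n" "v < n" "M ! v \<noteq> u"
  shows "owned (M[v := u]) x + of_bool (x = M ! v) = owned M x + of_bool (x = u)"
proof -
  have eq: "{w. w < n \<and> M[v := u] ! w = x} =
      (if x = u then insert v {w. w < n \<and> M ! w = x} else {w. w < n \<and> M ! w = x} - {v})"
    using assms by (auto simp: nth_list_update)
  have fin: "finite {w. w < n \<and> M ! w = x}" by simp
  show ?thesis
  proof (cases "x = u")
    case True
    then show ?thesis using assms(3) fin unfolding owned_def eq by simp
  next
    case False
    then show ?thesis using assms(2,3) fin card_Suc_Diff1[OF fin, of v]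
      unfolding owned_def eq by (cases "x = M ! v") auto
  qed
qed

lemma keys_update: "length W = Suc n \<Longrightarrow> m \<le> n \<Longrightarrow> keys (W[m := Some x]) = insert m (keys W)"
  by (auto simp: keys_def nth_list_update)

text \<open>One link of an alternating path: \<open>u\<close>, which lacks a vertex under
  \<open>M'\<close>, takes \<open>v\<close> from its owner, and the lack moves on to that
  owner.\<close>

lemma inner_step_inv:
  assumes M: "assignment s T D M" and inv: "reach_inv s T D M W"
    and u: "u < n" "W ! u = Some M'" and v: "v < n"
    and s: "s < n" "T \<subseteq> {..<n}"
  shows "reach_inv s T D M (inner_step M u M' v W)"
    "inner_step M u M' v W = W \<or> keys W \<subset> keys (inner_step M u M' v W)"
    "inner_step M u M' v W ! u = Some M'"
    "inner_step M u M' v W = W \<longrightarrow> R u v \<longrightarrow> M ! v \<in> keys W"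
proof -
  let ?m = "M ! v" let ?N = "M'[v := u]" let ?W = "W[?m := Some ?N]"
  have mn: "?m \<le> n" using M v s by (auto simp: assignment_def split: if_splits)
  have len: "length W = Suc n" using inv by (simp add: reach_inv_def)
  have *: "reach_inv s T D M ?W \<and> keys W \<subset> keys ?W \<and> ?W ! u = Some M'"
    if new: "W ! ?m = None" "R u v"
  proof -
    have nk: "?m \<notin> keys W" using new by (simp add: keys_def)
    have keys: "keys ?W = insert ?m (keys W)" using len mn by (simp add: keys_update)
    have uk: "u \<in> keys W" using u by (simp add: keys_def)
    have M': "assignment s T D M'" "\<forall>v<n. M' ! v = M ! v \<or> M ! v \<in> keys W"
      "\<forall>x. owned M' x + of_bool (x = u) = owned M x + of_bool (x = s)"
      using inv u unfolding reach_inv_def by (meson less_imp_le)+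
    have sk: "s \<in> keys W" "keys W \<inter> T = {}" using inv by (auto simp: reach_inv_def)
    \<comment> \<open>The owner of \<open>v\<close> is not reached yet, so the earlier reassignments
      left \<open>v\<close> alone.\<close>
    have M'v: "M' ! v = ?m" using M'(2) v nk by auto
    have vD: "v \<notin> D" using M v nk sk by (auto simp: assignment_def)
    have "?m \<notin> T" using assignmentD[OF M v vD] s by auto
    have lM': "length M' = n" using M' by (simp add: assignment_def)
    have um: "?m \<noteq> u" using nk uk by auto
    have A: "assignment s T D ?N"
      using M'(1) u(1) v uk sk(2) new(2) vD unfolding assignment_def
      by (auto simp: nth_list_update)
    have B: "\<forall>w<n. ?N ! w = M ! w \<or> M ! w \<in> keys ?W"
      using M'(2) lM' v keys by (auto simp: nth_list_update)
    have C: "\<forall>x. owned ?N x + of_bool (x = ?m) = owned M x + of_bool (x = s)"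
      using owned_update[OF lM' v] M'v um M'(3) by metis
    have "reach_inv s T D M ?W"
      unfolding reach_inv_def
    proof (intro conjI allI impI)
      show "length ?W = Suc n" using len by simp
      show "s \<in> keys ?W" "keys ?W \<inter> T = {}" using keys sk \<open>?m \<notin> T\<close> by auto
    next
      fix Y assume Y: "s \<in> Y" "\<forall>u\<in>Y. \<forall>v<n. R u v \<longrightarrow> M ! v \<in> Y"
      then have "keys W \<subseteq> Y" using inv by (simp add: reach_inv_def)
      then show "keys ?W \<subseteq> Y" using keys Y(2) uk v new(2) by auto
    next
      fix u' M'' assume 1: "u' \<le> n" "?W ! u' = Some M''"
      have "assignment s T D M'' \<and> (\<forall>w<n. M'' ! w = M ! w \<or> M ! w \<in> keys ?W) \<and>
        (\<forall>x. owned M'' x + of_bool (x = u') = owned M x + of_bool (x = s))"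
      proof (cases "u' = ?m")
        case True
        then have "M'' = ?N" using 1 len by simp
        then show ?thesis using A B C True by simp
      next
        case False
        then have "W ! u' = Some M''" using 1 by simp
        then have "assignment s T D M'' \<and> (\<forall>w<n. M'' ! w = M ! w \<or> M ! w \<in> keys W) \<and>
          (\<forall>x. owned M'' x + of_bool (x = u') = owned M x + of_bool (x = s))"
          using inv 1(1) unfolding reach_inv_def by meson
        then show ?thesis using keys by auto
      qed
      then show "assignment s T D M''"
        "\<And>w. w < n \<Longrightarrow> M'' ! w = M ! w \<or> M ! w \<in> keys ?W"
        "\<And>x. owned M'' x + of_bool (x = u') = owned M x + of_bool (x = s)" by auto
    qed
    then show ?thesis using keys nk u um by auto
  qed
  show "reach_inv s T D M (inner_step M u M' v W)" "inner_step M u M' v W ! u = Some M'"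
    using * inv u by (auto simp: inner_step_def)
  show "inner_step M u M' v W = W \<or> keys W \<subset> keys (inner_step M u M' v W)"
    using * by (auto simp: inner_step_def)
  show "inner_step M u M' v W = W \<longrightarrow> R u v \<longrightarrow> M ! v \<in> keys W"
    using * mn by (auto simp: inner_step_def keys_def)
qed

text \<open>Keys never shrink, so a fold without growth consists of steps that all do nothing. A
  fixed point of \<open>round\<close> is therefore fixed by every single step.\<close>

lemma fold_progress:
  assumes "\<And>x y. x \<in> set xs \<Longrightarrow> I y \<Longrightarrow> I (f x y) \<and> (f x y = y \<or> K y \<subset> (K (f x y) :: 'b set))"
    and "I y"
  shows "I (fold f xs y) \<and> ((\<forall>x\<in>set xs. f x y = y) \<and> fold f xs y = y \<or> K y \<subset> K (fold f xs y))"
  using assms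
proof (induction xs arbitrary: y)
  case (Cons x xs)
  have "I (f x y)" "f x y = y \<or> K y \<subset> K (f x y)" using Cons.prems by auto
  moreover have "I (fold f xs (f x y)) \<and>
     ((\<forall>z\<in>set xs. f z (f x y) = f x y) \<and> fold f xs (f x y) = f x y \<or> K (f x y) \<subset> K (fold f xs (f x y)))"
    using Cons.prems \<open>I (f x y)\<close> by (intro Cons.IH) auto
  ultimately show ?case by (auto intro: psubset_trans)
qed simp

lemma outer_step_inv:
  assumes M: "assignment s T D M" and inv: "reach_inv s T D M W" and u: "u < n"
    and s: "s < n" "T \<subseteq> {..<n}"
  shows "reach_inv s T D M (outer_step M u W)"
    "outer_step M u W = W \<or> keys W \<subset> keys (outer_step M u W)"
    "outer_step M u W = W \<longrightarrow> u \<in> keys W \<longrightarrow> (\<forall>v<n. R u v \<longrightarrow> M ! v \<in> keys W)"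
proof -
  have "reach_inv s T D M (outer_step M u W) \<and>
    (outer_step M u W = W \<or> keys W \<subset> keys (outer_step M u W)) \<and>
    (outer_step M u W = W \<longrightarrow> u \<in> keys W \<longrightarrow> (\<forall>v<n. R u v \<longrightarrow> M ! v \<in> keys W))"
  proof (cases "W ! u")
    case None
    then show ?thesis using inv by (simp add: outer_step_def keys_def)
  next
    case (Some M')
    let ?I = "\<lambda>W. reach_inv s T D M W \<and> W ! u = Some M'"
    have "?I (fold (inner_step M u M') (rev [0..<n]) W) \<and>
      ((\<forall>v\<in>set (rev [0..<n]). inner_step M u M' v W = W) \<and> fold (inner_step M u M') (rev [0..<n]) W = W \<or>
       keys W \<subset> keys (fold (inner_step M u M') (rev [0..<n]) W))"
    proof (rule fold_progress[where I = ?I])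
      fix v W' assume "v \<in> set (rev [0..<n])" "?I W'"
      then show "?I (inner_step M u M' v W') \<and>
          (inner_step M u M' v W' = W' \<or> keys W' \<subset> keys (inner_step M u M' v W'))"
        using inner_step_inv(1-3)[OF M _ u _ _ s, of W' M' v] by simp
    qed (use inv Some in simp)
    then show ?thesis
      using inner_step_inv(4)[OF M inv u Some _ s] by (auto simp: outer_step_def Some)
  qed
  then show "reach_inv s T D M (outer_step M u W)"
    "outer_step M u W = W \<or> keys W \<subset> keys (outer_step M u W)"
    "outer_step M u W = W \<longrightarrow> u \<in> keys W \<longrightarrow> (\<forall>v<n. R u v \<longrightarrow> M ! v \<in> keys W)" by auto
qed

lemma round_inv:
  assumes M: "assignment s T D M" and inv: "reach_inv s T D M W" and s: "s < n" "T \<subseteq> {..<n}"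
  shows "reach_inv s T D M (round M W)"
    "round M W = W \<or> keys W \<subset> keys (round M W)"
    "round M W = W \<longrightarrow> (\<forall>u\<in>keys W. u < n \<longrightarrow> (\<forall>v<n. R u v \<longrightarrow> M ! v \<in> keys W))"
proof -
  have *: "reach_inv s T D M (round M W) \<and>
      ((\<forall>u\<in>set (rev [0..<n]). outer_step M u W = W) \<and> round M W = W \<or> keys W \<subset> keys (round M W))"
    unfolding round_def
  proof (rule fold_progress[where I = "reach_inv s T D M"])
    fix u W' assume "u \<in> set (rev [0..<n])" "reach_inv s T D M W'"
    then show "reach_inv s T D M (outer_step M u W') \<and>
        (outer_step M u W' = W' \<or> keys W' \<subset> keys (outer_step M u W'))"
      using outer_step_inv(1,2)[OF M _ _ s, of W' u] by simp
  qed (rule inv)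
  then show "reach_inv s T D M (round M W)" "round M W = W \<or> keys W \<subset> keys (round M W)" by auto
  show "round M W = W \<longrightarrow> (\<forall>u\<in>keys W. u < n \<longrightarrow> (\<forall>v<n. R u v \<longrightarrow> M ! v \<in> keys W))"
  proof
    assume "round M W = W"
    then have "\<forall>u\<in>set (rev [0..<n]). outer_step M u W = W" using * by auto
    then show "\<forall>u\<in>keys W. u < n \<longrightarrow> (\<forall>v<n. R u v \<longrightarrow> M ! v \<in> keys W)"
      using outer_step_inv(3)[OF M inv _ s] by auto
  qed
qed

lemma reach:
  assumes M: "assignment s T D M" and s: "s < n" "T \<subseteq> {..<n}" "s \<notin> T"
  shows "reach_inv s T D M (reach s M)"
    "u \<in> keys (reach s M) \<Longrightarrow> u < n \<Longrightarrow> v < n \<Longrightarrow> R u v \<Longrightarrow> M ! v \<in> keys (reach s M)"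
proof -
  let ?W = "(replicate (Suc n) None)[s := Some M]"
  have k0: "keys (replicate (Suc n) None) = {}" by (auto simp: keys_def simp del: replicate_Suc)
  have k: "keys ?W = {s}" using s by (subst keys_update) (auto simp: k0 simp del: replicate_Suc)
  have get: "?W ! u = Some M' \<longleftrightarrow> u = s \<and> M' = M" if "u \<le> n" for u M'
    using that s(1) by (auto simp: nth_list_update simp del: replicate_Suc)
  have "reach_inv s T D M ?W"
    unfolding reach_inv_def k using M s get by (auto simp del: replicate_Suc)
  have fin: "finite (keys W)" for W by (simp add: keys_def)
  have *: "reach_inv s T D M (round M W) \<and> (round M W = W \<or> card (keys W) < card (keys (round M W))) \<and>
      card (keys W) \<le> Suc n" if "reach_inv s T D M W" for W
  proof -
    have "card (keys W) \<le> card {..n}" by (intro card_mono) (auto simp: keys_def)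
    then show ?thesis using round_inv(1,2)[OF M that s(1,2)] psubset_card_mono[OF fin] by auto
  qed
  have **: "round M (reach s M) = reach s M" "reach_inv s T D M (reach s M)"
    unfolding reach_def
    using iterate_fixpoint[where I = "reach_inv s T D M" and \<mu> = "\<lambda>W. card (keys W)" and b = "Suc n"
      and f = "round M" and x = ?W and k = n] * \<open>reach_inv s T D M ?W\<close> k by auto
  then show "reach_inv s T D M (reach s M)" by simp
  assume "u \<in> keys (reach s M)" "u < n" "v < n" "R u v"
  then show "M ! v \<in> keys (reach s M)" using round_inv(3)[OF M **(2) s(1,2)] **(1) by blast
qed

section \<open>Maximum assignments and the min-max argument\<close>

definition perfect :: "nat \<Rightarrow> nat set \<Rightarrow> nat set \<Rightarrow> nat list \<Rightarrow> bool" where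
  "perfect s T D M \<longleftrightarrow> assignment s T D M \<and> (\<forall>x<n. x \<notin> T \<longrightarrow> x \<noteq> s \<longrightarrow> owned M x = 1)"

text \<open>An entry at the pseudo-owner \<open>n\<close> moves one free vertex to the credit of
  \<open>s\<close> and leaves every other count unchanged.\<close>

lemma augment:
  assumes M: "perfect s T D M" and s: "s < n" "T \<subseteq> {..<n}" "s \<notin> T"
  shows "perfect s T D (augment s M)" "augment s M = M \<or> owned (augment s M) n < owned M n"
    "augment s M = M \<Longrightarrow> n \<notin> keys (reach s M)"
proof -
  have A: "assignment s T D M" using M by (simp add: perfect_def)
  have inv: "reach_inv s T D M (reach s M)" by (rule reach(1)[OF A s])
  have *: "perfect s T D M' \<and> owned M' n < owned M n" if "reach s M ! n = Some M'" for M'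
  proof -
    have "assignment s T D M'"
      and o: "\<And>x. owned M' x + of_bool (x = n) = owned M x + of_bool (x = s)"
      using inv that unfolding reach_inv_def by (meson le_refl)+
    moreover have "owned M' x = owned M x" if "x < n" "x \<noteq> s" for x using o[of x] that by simp
    ultimately show ?thesis using M o[of n] s by (auto simp: perfect_def)
  qed
  then show "perfect s T D (augment s M)" "augment s M = M \<or> owned (augment s M) n < owned M n"
    using M by (auto simp: augment_def split: option.split)
  show "n \<notin> keys (reach s M)" if "augment s M = M"
    using that * by (cases "reach s M ! n") (auto simp: augment_def keys_def)
qed

lemma max_assignment:
  assumes s: "s < n" "T \<subseteq> {..<n}" "s \<notin> T" "D \<subseteq> T"
  shows "perfect s T D (max_assignment s T D)" "n \<notin> keys (reach s (max_assignment s T D))"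
proof -
  let ?M = "map (init_owner s T D) [0..<n]"
  have nth: "?M ! v = init_owner s T D v" if "v < n" for v using that by simp
  have "assignment s T D ?M" using s by (auto simp: assignment_def init_owner_def)
  moreover have "owned ?M x = 1" if "x < n" "x \<notin> T" "x \<noteq> s" for x
  proof -
    have "{v. v < n \<and> ?M ! v = x} = {x}"
      using that s nth by (auto simp: init_owner_def split: if_splits)
    then show ?thesis by (simp add: owned_def)
  qed
  ultimately have p: "perfect s T D ?M" by (simp add: perfect_def)
  have le: "owned M n \<le> n" for M
    using card_mono[of "{..<n}" "{v. v < n \<and> M ! v = n}"] by (auto simp: owned_def)
  have st: "perfect s T D (augment s M) \<and> (augment s M = M \<or> n - owned M n < n - owned (augment s M) n) \<and>
      n - owned M n \<le> n" if "perfect s T D M" for M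
    using augment(1,2)[OF that s(1-3)] le[of M] by auto
  have "augment s (max_assignment s T D) = max_assignment s T D \<and> perfect s T D (max_assignment s T D)"
    unfolding max_assignment_def
    using iterate_fixpoint[where I = "perfect s T D" and \<mu> = "\<lambda>M. n - owned M n" and b = n
      and f = "augment s" and x = ?M and k = n] st p by auto
  then show "perfect s T D (max_assignment s T D)" "n \<notin> keys (reach s (max_assignment s T D))"
    using augment(3)[OF _ s(1-3)] by auto
qed

lemma card_owners:
  assumes "perfect s T D M" "s \<in> Y" "Y \<subseteq> {..<n}" "Y \<inter> T = {}"
  shows "card {v. v < n \<and> M ! v \<in> Y} + 1 = owned M s + card Y"
proof -
  have fY: "finite Y" using assms(3) by (rule finite_subset) simp
  have "{v. v < n \<and> M ! v \<in> Y} = (\<Union>x\<in>Y. {v. v < n \<and> M ! v = x})" by auto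
  moreover have "card \<dots> = (\<Sum>x\<in>Y. owned M x)"
    unfolding owned_def using fY by (intro card_UN_disjoint) auto
  moreover have "\<dots> = owned M s + (\<Sum>x\<in>Y - {s}. owned M x)" using fY assms(2) by (simp add: sum.remove)
  moreover have "(\<Sum>x\<in>Y - {s}. owned M x) = (\<Sum>x\<in>Y - {s}. 1)"
    using assms by (intro sum.cong) (auto simp: perfect_def)
  moreover have "(\<Sum>x\<in>Y - {s}. (1::nat)) + 1 = card Y" using card_Suc_Diff1[OF fY assms(2)] by simp
  ultimately show ?thesis by simp
qed

text \<open>Duality: the vertices owned by \<open>Y\<close> lie in \<open>cl Y \<union> D\<close>,
  so \<open>card (bd D Y)\<close> is at least \<open>owned M s - 1 - card D\<close> for the maximum
  assignment \<open>M\<close>. The reached set attains this bound, as it owns all of its closure and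
  \<open>D\<close>. If \<open>Y\<close> attains it too, then \<open>Y\<close> is closed under the
  reachability rule and contains the reached set.\<close>

lemma closest_cut_cut:
  assumes s: "s < n" "T \<subseteq> {..<n}" "s \<notin> T" "D \<subseteq> T"
  shows "closest_cut s T D (cut s T D)"
proof -
  let ?M = "max_assignment s T D" let ?W = "reach s ?M" let ?K = "keys ?W"
  have P: "perfect s T D ?M" and nK: "n \<notin> ?K" by (rule max_assignment[OF s])+
  have A: "assignment s T D ?M" using P by (simp add: perfect_def)
  have inv: "reach_inv s T D ?M ?W" by (rule reach(1)[OF A s(1-3)])
  have cutK: "cut s T D = ?K"
    using nK by (auto simp: cut_def cut_of_def keys_def order.order_iff_strict)
  have K: "s \<in> ?K" "?K \<subseteq> {..<n}" "?K \<inter> T = {}"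
    using inv nK by (auto simp: reach_inv_def keys_def order.order_iff_strict)
  have own: "{v. v < n \<and> ?M ! v \<in> Y} \<subseteq> cl Y \<union> D" if "n \<notin> Y" for Y
  proof
    fix v assume v: "v \<in> {v. v < n \<and> ?M ! v \<in> Y}"
    then have "v \<notin> D \<Longrightarrow> R (?M ! v) v" using assignmentD[OF A, of v] that by auto
    then show "v \<in> cl Y \<union> D" using v by (auto simp: cl_def)
  qed
  have f: "card (cl Y \<union> D) + 1 = card (bd D Y) + card Y + card D + 1"
    if "Y \<subseteq> {..<n}" "Y \<inter> T = {}" for Y
    using card_cl_Un[of Y D] that s by auto
  have "?M ! v \<in> ?K" if "v \<in> cl ?K" for v
    using that reach(2)[OF A s(1-3)] K(2) by (auto simp: cl_def)
  moreover have "?M ! v \<in> ?K" if "v \<in> D" for v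
    using that A K(1) s by (auto simp: assignment_def)
  ultimately have "{v. v < n \<and> ?M ! v \<in> ?K} = cl ?K \<union> D"
    using own[OF nK] cl_less s by blast
  then have fK: "card (bd D ?K) + card ?K + card D + 1 = owned ?M s + card ?K"
    using f[OF K(2,3)] card_owners[OF P K] by simp
  have "card (bd D ?K) \<le> card (bd D Y) \<and> (card (bd D ?K) = card (bd D Y) \<longrightarrow> ?K \<subseteq> Y)"
    if Y: "s \<in> Y" "Y \<subseteq> {..<n}" "Y \<inter> T = {}" for Y
  proof -
    have nY: "n \<notin> Y" using Y by auto
    have fin: "finite (cl Y \<union> D)" using s by (auto intro: finite_subset[of D "{..<n}"])
    have le: "card {v. v < n \<and> ?M ! v \<in> Y} \<le> card (cl Y \<union> D)"
      using own[OF nY] fin by (intro card_mono)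
    note c = card_owners[OF P Y] f[OF Y(2,3)] fK
    have "?K \<subseteq> Y" if eq: "card (bd D ?K) = card (bd D Y)"
    proof -
      have "card (cl Y \<union> D) \<le> card {v. v < n \<and> ?M ! v \<in> Y}" using c eq by linarith
      then have "{v. v < n \<and> ?M ! v \<in> Y} = cl Y \<union> D"
        using own[OF nY] fin by (intro card_seteq)
      then have "\<forall>u\<in>Y. \<forall>v<n. R u v \<longrightarrow> ?M ! v \<in> Y" by (auto simp: cl_def)
      then show ?thesis using inv Y(1) unfolding reach_inv_def by blast
    qed
    moreover have "card (bd D ?K) \<le> card (bd D Y)" using c le by linarith
    ultimately show ?thesis by blast
  qed
  then show ?thesis unfolding closest_cut_def cutK using K by blast
qed

end

sublocale reflexive_graph \<subseteq> graph_with_cuts n R cut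
  by unfold_locales (rule closest_cut_cut)

section \<open>Programs and their costs\<close>

text \<open>As \<open>eval\<close> is deterministic, the existential form is a weakest precondition,
  and it includes termination.\<close>

definition wp :: "program \<Rightarrow> val list \<Rightarrow> exp \<Rightarrow> (val \<Rightarrow> nat \<Rightarrow> bool) \<Rightarrow> bool" where
  "wp p env e Q \<longleftrightarrow> (\<exists>v c. eval p env e v c \<and> Q v c)"

definition wps :: "program \<Rightarrow> val list \<Rightarrow> exp list \<Rightarrow> (val list \<Rightarrow> nat \<Rightarrow> bool) \<Rightarrow> bool" where
  "wps p env es Q \<longleftrightarrow> (\<exists>vs c. evals p env es vs c \<and> Q vs c)"

text \<open>An opaque stop for symbolic execution, which would otherwise unfold recursive bodies
  forever; \<open>returns_call\<close> resumes it from a known result.\<close>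

definition wp_call :: "program \<Rightarrow> nat \<Rightarrow> val list \<Rightarrow> (val \<Rightarrow> nat \<Rightarrow> bool) \<Rightarrow> bool" where
  "wp_call p f vs Q \<longleftrightarrow> wp p vs (p ! f) Q"

lemma wp_simps [simp]:
  "wp p env (VarE i) Q \<longleftrightarrow> i < length env \<and> Q (env ! i) 1"
  "wp p env NullE Q \<longleftrightarrow> Q Null 1"
  "wp p env (CellE a b) Q \<longleftrightarrow> wp p env a (\<lambda>v c. wp p env b (\<lambda>w d. Q (Cell v w) (c + d + 1)))"
  "wp p env (FstE a) Q \<longleftrightarrow> wp p env a (\<lambda>v c. Q (val_fst v) (c + 1))"
  "wp p env (SndE a) Q \<longleftrightarrow> wp p env a (\<lambda>v c. Q (val_snd v) (c + 1))"
  "wp p env (IfE b a1 a2) Q \<longleftrightarrow> wp p env b (\<lambda>v c.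
     if v = Null then wp p env a2 (\<lambda>w d. Q w (c + d + 1)) else wp p env a1 (\<lambda>w d. Q w (c + d + 1)))"
  "wp p env (LetE a b) Q \<longleftrightarrow> wp p env a (\<lambda>v c. wp p (v # env) b (\<lambda>w d. Q w (c + d + 1)))"
  "wp p env (CallE f as) Q \<longleftrightarrow> f < length p \<and>
     wps p env as (\<lambda>vs c. wp_call p f vs (\<lambda>w d. Q w (c + d + 1)))"
  "wps p env [] Q' \<longleftrightarrow> Q' [] 0"
  "wps p env (a # as) Q' \<longleftrightarrow> wp p env a (\<lambda>v c. wps p env as (\<lambda>vs d. Q' (v # vs) (c + d)))"
  unfolding wp_def wps_def wp_call_def
  by (fastforce elim: eval_VarE eval_NullE eval_CellE eval_FstE eval_SndE eval_IfE eval_LetE eval_CallE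
      evals_NilE evals_ConsE intro: eval_evals.intros split: if_splits)+

definition returns :: "program \<Rightarrow> nat \<Rightarrow> val list \<Rightarrow> val \<Rightarrow> nat \<Rightarrow> bool" where
  "returns p f vs r b \<longleftrightarrow> (\<exists>c\<le>b. eval p vs (p ! f) r c)"

text \<open>The exact cost as a term: execution carries it along, and \<open>returns_cost\<close>
  supplies upper bounds for the final arithmetic.\<close>

definition cost :: "program \<Rightarrow> nat \<Rightarrow> val list \<Rightarrow> nat" where
  "cost p f vs = (THE c. \<exists>r. eval p vs (p ! f) r c)"

lemma returnsI: "wp p vs (p ! f) (\<lambda>v c. v = r \<and> c \<le> b) \<Longrightarrow> returns p f vs r b"
  by (auto simp: wp_def returns_def)

lemma returns_mono: "returns p f vs r b \<Longrightarrow> b \<le> b' \<Longrightarrow> returns p f vs r b'"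
  unfolding returns_def by (meson le_trans)

lemma cost_eq: "eval p vs (p ! f) r c \<Longrightarrow> cost p f vs = c"
  unfolding cost_def by (rule the_equality) (auto dest: eval_deterministic)

lemma returns_cost: "returns p f vs r b \<Longrightarrow> cost p f vs \<le> b"
  by (auto simp: returns_def cost_eq)

lemma returns_call: "returns p f vs r b \<Longrightarrow> wp_call p f vs Q \<longleftrightarrow> Q r (cost p f vs)"
  unfolding wp_call_def wp_def returns_def by (metis cost_eq eval_deterministic(1))

text \<open>A loop over the list in variable 0, with an accumulator in variable 1 and a constant in variable 2.\<close>

definition fold_body :: "nat \<Rightarrow> exp \<Rightarrow> exp" where
  "fold_body i step = IfE (VarE 0) (CallE i [SndE (VarE 0), step, VarE 2]) (VarE 1)"

text \<open>\<open>h\<close> and \<open>A\<close> encode list elements and accumulators. Besides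
  \<open>step\<close>, each round of \<open>fold_body\<close> costs 6 for the test, the two other
  arguments and the call; the final test and result cost 3.\<close>

lemma returns_fold:
  assumes "i < length p" "p ! i = fold_body i step"
    and "\<And>x ys a. x \<in> set xs \<Longrightarrow> I a \<Longrightarrow>
      I (g x a) \<and> wp p [Cell (h x) ys, A a, e] step (\<lambda>v c. v = A (g x a) \<and> c \<le> b)"
    and "I a"
  shows "returns p i [enc_list (map h xs), A a, e] (A (fold g xs a)) (length xs * (b + 6) + 3)"
  using assms(3-)
proof (induction xs arbitrary: a)
  case Nil
  show ?case by (rule returnsI) (simp add: assms(2) fold_body_def)
next
  case (Cons x xs)
  have IH: "returns p i [enc_list (map h xs), A (g x a), e] (A (fold g xs (g x a))) (length xs * (b + 6) + 3)"
    using Cons.prems by (intro Cons.IH) auto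
  have "wp p [Cell (h x) (enc_list (map h xs)), A a, e] step (\<lambda>v c. v = A (g x a) \<and> c \<le> b)"
    using Cons.prems by auto
  then obtain c where c: "eval p [Cell (h x) (enc_list (map h xs)), A a, e] step (A (g x a)) c" "c \<le> b"
    by (auto simp: wp_def)
  then have "wp p [Cell (h x) (enc_list (map h xs)), A a, e] step Q \<longleftrightarrow> Q (A (g x a)) c" for Q
    by (auto simp: wp_def dest: eval_deterministic)
  then show ?case using returns_cost[OF IH] c(2)
    by (intro returnsI) (simp add: assms(1,2) fold_body_def returns_call[OF IH])
qed

fun num :: "nat \<Rightarrow> val" where
  "num 0 = Null"
| "num (Suc i) = Cell Null (num i)"

lemma val_fst_enc_list: "i < length xs \<Longrightarrow> val_fst (enc_list (drop i xs)) = xs ! i"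
  by (cases "drop i xs") (auto simp: hd_drop_conv_nth[symmetric])

lemma val_snd_enc_list [simp]: "val_snd (enc_list xs) = enc_list (tl xs)"
  by (cases xs) auto

text \<open>A unary number is also a list of \<open>Null\<close> entries: \<open>drop_fn\<close>
  thus serves as truncated subtraction, \<open>n\<close> as the empty set and \<open>Suc n\<close>
  as the empty table.\<close>

lemma enc_list_Null: "enc_list (replicate i Null) = num i"
  by (induction i) auto

lemma val_snd_num [simp]: "val_snd (num i) = num (i - 1)"
  by (cases i) auto

lemma num_Null [simp]: "num i = Null \<longleftrightarrow> i = 0"
  by (cases i) auto

lemma enc_bool_simps [simp]: "enc_bool b = Null \<longleftrightarrow> \<not> b" "enc_bool False = Null"
  by (auto simp: enc_bool_def)

lemma enc_bool_True: "enc_bool True = Cell Null Null"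
  by (simp add: enc_bool_def)

lemma enc_list_Null_iff [simp]: "enc_list xs = Null \<longleftrightarrow> xs = []"
  by (cases xs) auto

section \<open>The program\<close>

definition "main_fn = (0 :: nat)"
definition "drop_fn = (1 :: nat)"
definition "update_fn = (2 :: nat)"
definition "union_fn = (3 :: nat)"
definition "diff_fn = (4 :: nat)"
definition "closure_fn = (5 :: nat)"
definition "boundary_fn = (6 :: nat)"
definition "count_fn = (7 :: nat)"
definition "pick_fn = (8 :: nat)"
definition "init_fn = (9 :: nat)"
definition "inner_fn = (10 :: nat)"
definition "outer_fn = (11 :: nat)"
definition "rounds_fn = (12 :: nat)"
definition "reach_fn = (13 :: nat)"
definition "augment_fn = (14 :: nat)"
definition "keys_fn = (15 :: nat)"
definition "cut_fn = (16 :: nat)"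
definition "cut_size_fn = (17 :: nat)"
definition "best_fn = (18 :: nat)"
definition "solve_fn = (19 :: nat)"
definition "enum_fn = (20 :: nat)"
definition "any_fn = (21 :: nat)"
definition "numeral_fn = (22 :: nat)"
definition "reflexive_fn = (23 :: nat)"
definition "vertices_fn = (24 :: nat)"
definition "add_fn = (25 :: nat)"

lemmas fn_defs = main_fn_def drop_fn_def update_fn_def union_fn_def diff_fn_def closure_fn_def
  boundary_fn_def count_fn_def pick_fn_def init_fn_def inner_fn_def outer_fn_def rounds_fn_def
  reach_fn_def augment_fn_def keys_fn_def cut_fn_def cut_size_fn_def best_fn_def solve_fn_def
  enum_fn_def any_fn_def numeral_fn_def reflexive_fn_def vertices_fn_def add_fn_def

abbreviation "TrueE \<equiv> CellE NullE NullE"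
abbreviation "nthE i x \<equiv> FstE (CallE drop_fn [i, x])"

text \<open>
  Numbers are unary, sets are tables of truth values, and the graph is passed around as the
  quadruple of the vertex list, the reflexive adjacency matrix, \<open>n\<close> and \<open>k\<close>.
\<close>

abbreviation "verticesE e \<equiv> FstE (FstE e)"
abbreviation "matrixE e \<equiv> SndE (FstE e)"
abbreviation "orderE e \<equiv> FstE (SndE e)"
abbreviation "limitE e \<equiv> SndE (SndE e)"

definition "drop_body = IfE (VarE 0) (CallE drop_fn [SndE (VarE 0), SndE (VarE 1)]) (VarE 1)"

definition "update_body = IfE (VarE 0)
  (CellE (FstE (VarE 1)) (CallE update_fn [SndE (VarE 0), SndE (VarE 1), VarE 2]))
  (CellE (VarE 2) (SndE (VarE 1)))"

definition "union_body = IfE (VarE 0)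
  (CellE (IfE (FstE (VarE 0)) TrueE (FstE (VarE 1))) (CallE union_fn [SndE (VarE 0), SndE (VarE 1)]))
  NullE"

definition "diff_body = IfE (VarE 0)
  (CellE (IfE (FstE (VarE 1)) NullE (FstE (VarE 0))) (CallE diff_fn [SndE (VarE 0), SndE (VarE 1)]))
  NullE"

definition "closure_body = IfE (VarE 0)
  (CallE closure_fn [SndE (VarE 0), SndE (VarE 1),
     IfE (FstE (VarE 0)) (CallE union_fn [VarE 2, FstE (VarE 1)]) (VarE 2)])
  (VarE 2)"

definition "boundary_body =
  CallE diff_fn [CallE diff_fn [CallE closure_fn [VarE 0, VarE 2, VarE 0], VarE 0], VarE 1]"

definition "count_body = IfE (VarE 0)
  (CallE count_fn [SndE (VarE 0), IfE (FstE (VarE 0)) (CellE NullE (VarE 1)) (VarE 1)])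
  (VarE 1)"

definition "pick_body = IfE (FstE (VarE 0)) NullE (CellE NullE (CallE pick_fn [SndE (VarE 0)]))"

definition "init_body = IfE (VarE 0)
  (CellE (IfE (FstE (VarE 1)) (VarE 3) (IfE (FstE (VarE 0)) (VarE 4) (VarE 2)))
     (CallE init_fn [SndE (VarE 0), SndE (VarE 1), CellE NullE (VarE 2), VarE 3, VarE 4]))
  NullE"

definition "inner_body = fold_body inner_fn
  (LetE (nthE (FstE (VarE 0)) (FstE (SndE (VarE 2))))
     (IfE (nthE (VarE 0) (VarE 2)) (VarE 2)
       (IfE (nthE (FstE (VarE 1)) (SndE (SndE (VarE 3))))
         (CallE update_fn [VarE 0, VarE 2,
            CellE NullE (CallE update_fn [FstE (VarE 1), SndE (FstE (VarE 3)), FstE (FstE (VarE 3))])])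
         (VarE 2))))"

definition "outer_body = fold_body outer_fn
  (LetE (nthE (FstE (VarE 0)) (VarE 1))
     (IfE (VarE 0)
       (CallE inner_fn [FstE (SndE (VarE 3)), VarE 2,
          CellE (CellE (FstE (VarE 1)) (SndE (VarE 0)))
            (CellE (FstE (VarE 3)) (nthE (FstE (VarE 1)) (SndE (SndE (VarE 3)))))])
       (VarE 2)))"

definition "rounds_body = fold_body rounds_fn (CallE outer_fn [FstE (SndE (VarE 2)), VarE 1, VarE 2])"

text \<open>The empty table is the unary number \<open>Suc n\<close>, and the vertex list merely
  counts the rounds.\<close>

definition "reach_body = CallE rounds_fn [verticesE (VarE 2),
  CallE update_fn [VarE 0, CellE NullE (orderE (VarE 2)), CellE NullE (VarE 1)],
  CellE (VarE 1) (FstE (VarE 2))]"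

definition "augment_body = fold_body augment_fn
  (LetE (nthE (orderE (SndE (VarE 2))) (CallE reach_fn [FstE (VarE 2), VarE 1, SndE (VarE 2)]))
     (IfE (VarE 0) (SndE (VarE 0)) (VarE 2)))"

text \<open>Stops one entry early, because the last entry belongs to the free owner
  \<open>n\<close>, which is not a vertex.\<close>

definition "keys_body = IfE (SndE (VarE 0))
  (CellE (IfE (FstE (VarE 0)) TrueE NullE) (CallE keys_fn [SndE (VarE 0)])) NullE"

definition "cut_body = CallE keys_fn [CallE reach_fn [VarE 0,
  CallE augment_fn [verticesE (VarE 3),
    CallE init_fn [VarE 1, VarE 2, NullE, VarE 0, orderE (VarE 3)], CellE (VarE 0) (VarE 3)],
  VarE 3]]"

definition "cut_size_body = CallE count_fn [CallE boundary_fn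
  [CallE cut_fn [VarE 0, VarE 1, VarE 2, VarE 3], VarE 2, matrixE (VarE 3)], NullE]"

text \<open>Here the constant is \<open>((s, Z), ((T, D), g))\<close>.\<close>

definition "best_body = fold_body best_fn
  (IfE (nthE (FstE (VarE 0)) (SndE (FstE (VarE 2))))
     (IfE (nthE (FstE (VarE 0)) (nthE (FstE (FstE (VarE 2))) (matrixE (SndE (SndE (VarE 2))))))
       (VarE 1)
       (LetE (CallE cut_size_fn [FstE (FstE (VarE 2)),
           CallE union_fn [FstE (FstE (SndE (VarE 2))), nthE (FstE (VarE 0)) (matrixE (SndE (SndE (VarE 2))))],
           SndE (FstE (SndE (VarE 2))), SndE (SndE (VarE 2))])
         (IfE (CallE drop_fn [VarE 0, FstE (VarE 2)]) (CellE (VarE 0) (FstE (VarE 1))) (VarE 2))))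
     (VarE 1))"

text \<open>A comparison is a truncated difference, non-\<open>Null\<close> iff the minuend is
  larger. For the limit \<open>k + t\<close> the two terms are subtracted in turn, so no subtrahend
  exceeds \<open>n\<close>.\<close>

definition "solve_body = IfE (VarE 0)
  (LetE (CallE cut_fn [VarE 1, VarE 2, VarE 3, VarE 5])
  (LetE (CallE boundary_fn [VarE 0, VarE 4, matrixE (VarE 6)])
  (LetE (CallE count_fn [VarE 0, NullE])
  (IfE (CallE drop_fn [VarE 7, VarE 0]) NullE
  (IfE (CallE drop_fn [limitE (VarE 8), CallE drop_fn [VarE 7, CallE count_fn [VarE 2, VarE 0]]])
    (IfE (VarE 0)
      (LetE (CallE pick_fn [VarE 1])
        (IfE (CallE solve_fn [SndE (VarE 4), VarE 5, CallE update_fn [VarE 0, VarE 6, TrueE],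
            CallE update_fn [VarE 0, VarE 7, TrueE], SndE (VarE 8), VarE 9])
          TrueE
          (IfE (nthE (VarE 0) (nthE (VarE 5) (matrixE (VarE 9)))) NullE
            (CallE solve_fn [SndE (VarE 4), VarE 5,
              CallE union_fn [VarE 6, nthE (VarE 0) (matrixE (VarE 9))], VarE 7, VarE 8, VarE 9]))))
      (LetE (CallE best_fn [verticesE (VarE 8), CellE (CellE NullE (orderE (VarE 8))) (VarE 4),
          CellE (CellE (VarE 4) (VarE 2)) (CellE (CellE (VarE 5) (VarE 6)) (VarE 8))])
        (IfE (CallE drop_fn [VarE 8, FstE (VarE 0)]) NullE
          (CallE solve_fn [SndE (VarE 4), VarE 5,
            CallE union_fn [VarE 6, nthE (SndE (VarE 0)) (matrixE (VarE 9))], VarE 7, VarE 8, VarE 9]))))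
    TrueE)))))
  NullE"

definition "enum_body = IfE (VarE 0)
  (LetE (CallE boundary_fn [VarE 1, VarE 2, matrixE (VarE 4)])
  (IfE (CallE drop_fn [VarE 4, CallE count_fn [VarE 0, NullE]])
    (LetE (CallE pick_fn [VarE 0])
      (IfE (CallE enum_fn [SndE (VarE 2), CallE update_fn [VarE 0, VarE 3, TrueE], VarE 4, VarE 5, VarE 6])
        TrueE
        (IfE (VarE 5)
          (CallE enum_fn [SndE (VarE 2), VarE 3, CallE update_fn [VarE 0, VarE 4, TrueE],
            SndE (VarE 5), VarE 6])
          NullE)))
    (IfE (CallE drop_fn [limitE (VarE 5), CallE count_fn [VarE 2, NullE]]) NullE TrueE)))
  NullE"

text \<open>Here the constant is \<open>(m, (t, g))\<close>; the number \<open>n\<close> doubles as the table of the empty set.\<close>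

definition "any_body = fold_body any_fn
  (IfE (VarE 1) (VarE 1)
    (IfE (CallE enum_fn [FstE (VarE 2),
        CallE update_fn [FstE (VarE 0), orderE (SndE (SndE (VarE 2))), TrueE],
        orderE (SndE (SndE (VarE 2))), FstE (SndE (VarE 2)), SndE (SndE (VarE 2))])
      TrueE
      (CallE solve_fn [FstE (VarE 2), FstE (VarE 0), orderE (SndE (SndE (VarE 2))),
        orderE (SndE (SndE (VarE 2))), FstE (SndE (VarE 2)), SndE (SndE (VarE 2))])))"

text \<open>
  Converts a binary number to unary, truncated to \<open>n\<close> (variable 2), reading at most as many bits
  as variable 1 says: if digits remain after that, then the number exceeds \<open>n\<close>.
\<close>

definition "numeral_body = IfE (VarE 0)
  (IfE (VarE 1)
    (LetE (CallE numeral_fn [SndE (VarE 0), SndE (VarE 1), VarE 2])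
      (CallE drop_fn [CallE drop_fn [VarE 0, CallE drop_fn [VarE 0,
         IfE (FstE (VarE 1)) (SndE (VarE 3)) (VarE 3)]], VarE 3]))
    (VarE 2))
  NullE"

definition "reflexive_body = IfE (VarE 0)
  (CellE (CallE update_fn [VarE 1, FstE (VarE 0), TrueE])
    (CallE reflexive_fn [SndE (VarE 0), CellE NullE (VarE 1)]))
  NullE"

definition "vertices_body = IfE (VarE 0)
  (CallE vertices_fn [SndE (VarE 0), CellE NullE (VarE 1), CellE (VarE 1) (VarE 2)])
  (CellE (VarE 1) (VarE 2))"

definition "add_body = IfE (VarE 0) (CellE NullE (CallE add_fn [SndE (VarE 0), VarE 1])) (VarE 1)"

definition "main_body =
  LetE (CallE vertices_fn [FstE (VarE 0), NullE, NullE])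
  (LetE (CellE (CellE (SndE (VarE 0)) (CallE reflexive_fn [FstE (VarE 1), NullE]))
      (CellE (FstE (VarE 0)) (CallE numeral_fn [FstE (SndE (VarE 1)), FstE (VarE 0), FstE (VarE 0)])))
  (LetE (CallE numeral_fn [SndE (SndE (VarE 2)), FstE (VarE 1), FstE (VarE 1)])
    (CallE any_fn [SndE (VarE 2), NullE,
      CellE (CellE NullE (CallE add_fn [VarE 0, VarE 0])) (CellE (VarE 0) (VarE 1))])))"

definition cut_program :: program where
  "cut_program = [main_body, drop_body, update_body, union_body, diff_body, closure_body,
     boundary_body, count_body, pick_body, init_body, inner_body, outer_body, rounds_body,
     reach_body, augment_body, keys_body, cut_body, cut_size_body, best_body, solve_body,
     enum_body, any_body, numeral_body, reflexive_body, vertices_body, add_body]"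

lemma cut_program_nth [simp]:
  "cut_program ! main_fn = main_body" "cut_program ! drop_fn = drop_body"
  "cut_program ! update_fn = update_body" "cut_program ! union_fn = union_body"
  "cut_program ! diff_fn = diff_body" "cut_program ! closure_fn = closure_body"
  "cut_program ! boundary_fn = boundary_body" "cut_program ! count_fn = count_body"
  "cut_program ! pick_fn = pick_body" "cut_program ! init_fn = init_body"
  "cut_program ! inner_fn = inner_body" "cut_program ! outer_fn = outer_body"
  "cut_program ! rounds_fn = rounds_body" "cut_program ! reach_fn = reach_body"
  "cut_program ! augment_fn = augment_body" "cut_program ! keys_fn = keys_body"
  "cut_program ! cut_fn = cut_body" "cut_program ! cut_size_fn = cut_size_body"
  "cut_program ! best_fn = best_body" "cut_program ! solve_fn = solve_body"
  "cut_program ! enum_fn = enum_body" "cut_program ! any_fn = any_body"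
  "cut_program ! numeral_fn = numeral_body" "cut_program ! reflexive_fn = reflexive_body"
  "cut_program ! vertices_fn = vertices_body" "cut_program ! add_fn = add_body"
  by (simp_all add: cut_program_def fn_defs)

lemma fn_less_length [simp]:
  "main_fn < length cut_program" "drop_fn < length cut_program" "update_fn < length cut_program"
  "union_fn < length cut_program" "diff_fn < length cut_program" "closure_fn < length cut_program"
  "boundary_fn < length cut_program" "count_fn < length cut_program" "pick_fn < length cut_program"
  "init_fn < length cut_program" "inner_fn < length cut_program" "outer_fn < length cut_program"
  "rounds_fn < length cut_program" "reach_fn < length cut_program" "augment_fn < length cut_program"
  "keys_fn < length cut_program" "cut_fn < length cut_program" "cut_size_fn < length cut_program"
  "best_fn < length cut_program" "solve_fn < length cut_program" "enum_fn < length cut_program"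
  "any_fn < length cut_program" "numeral_fn < length cut_program"
  "reflexive_fn < length cut_program" "vertices_fn < length cut_program" "add_fn < length cut_program"
  by (simp_all add: cut_program_def fn_defs)

section \<open>List primitives\<close>

abbreviation "yields \<equiv> returns cut_program"

lemma drop_fn: "yields drop_fn [num i, enc_list xs] (enc_list (drop i xs)) (20 * i + 10)"
proof (induction i arbitrary: xs)
  case 0
  show ?case by (rule returnsI) (simp add: drop_body_def)
next
  case (Suc i)
  note IH = Suc[of "tl xs"]
  show ?case using returns_cost[OF IH]
    by (intro returnsI) (simp add: drop_body_def returns_call[OF IH] drop_Suc)
qed

lemma drop_fn_num: "yields drop_fn [num i, num j] (num (j - i)) (20 * i + 10)"
  using drop_fn[of i "replicate j Null"] by (simp add: enc_list_Null)

lemma update_fn: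
  "i < length xs \<Longrightarrow> yields update_fn [num i, enc_list xs, x] (enc_list (xs[i := x])) (20 * i + 10)"
proof (induction i arbitrary: xs)
  case 0
  then show ?case by (intro returnsI) (cases xs; simp add: update_body_def)
next
  case (Suc i)
  then obtain y ys where xs: "xs = y # ys" "i < length ys" by (cases xs) auto
  note IH = Suc.IH[OF xs(2)]
  show ?case using returns_cost[OF IH]
    by (intro returnsI) (simp add: update_body_def returns_call[OF IH] xs(1))
qed

lemma union_fn: "yields union_fn [enc_list (map (\<lambda>x. enc_bool (P x)) xs), enc_list (map (\<lambda>x. enc_bool (Q x)) xs)]
  (enc_list (map (\<lambda>x. enc_bool (P x \<or> Q x)) xs)) (20 * length xs + 10)"
proof (induction xs)
  case Nil
  show ?case by (rule returnsI) (simp add: union_body_def)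
next
  case (Cons x xs)
  show ?case using returns_cost[OF Cons.IH]
    by (intro returnsI) (simp add: union_body_def returns_call[OF Cons.IH] enc_bool_True)
qed

lemma diff_fn: "yields diff_fn [enc_list (map (\<lambda>x. enc_bool (P x)) xs), enc_list (map (\<lambda>x. enc_bool (Q x)) xs)]
  (enc_list (map (\<lambda>x. enc_bool (P x \<and> \<not> Q x)) xs)) (20 * length xs + 10)"
proof (induction xs)
  case Nil
  show ?case by (rule returnsI) (simp add: diff_body_def)
next
  case (Cons x xs)
  show ?case using returns_cost[OF Cons.IH]
    by (intro returnsI) (simp add: diff_body_def returns_call[OF Cons.IH] enc_bool_True)
qed

lemma count_fn: "yields count_fn [enc_list (map (\<lambda>x. enc_bool (P x)) xs), num j]
  (num (length (filter P xs) + j)) (20 * length xs + 10)"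
proof (induction xs arbitrary: j)
  case Nil
  show ?case by (rule returnsI) (simp add: count_body_def)
next
  case (Cons x xs)
  note IH = Cons.IH[of j] Cons.IH[of "Suc j"]
  show ?case using returns_cost[OF IH(1)] returns_cost[OF IH(2)]
    by (intro returnsI) (simp add: count_body_def returns_call[OF IH(1)] returns_call[OF IH(2), simplified])
qed

lemma pick_fn: "\<exists>i<length xs. P (xs ! i) \<Longrightarrow>
  yields pick_fn [enc_list (map (\<lambda>x. enc_bool (P x)) xs)] (num (LEAST i. P (xs ! i))) (20 * length xs + 10)"
proof (induction xs)
  case (Cons x xs)
  show ?case
  proof (cases "P x")
    case True
    then have "(LEAST i. P ((x # xs) ! i)) = 0" by (intro Least_equality) auto
    then show ?thesis using True by (intro returnsI) (simp add: pick_body_def)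
  next
    case False
    then obtain i where i: "i < length xs" "P (xs ! i)" using Cons.prems by (auto simp: less_Suc_eq_0_disj)
    then have IH: "yields pick_fn [enc_list (map (\<lambda>x. enc_bool (P x)) xs)] (num (LEAST i. P (xs ! i))) (20 * length xs + 10)"
      by (intro Cons.IH) auto
    have "(LEAST i. P ((x # xs) ! i)) = Suc (LEAST i. P ((x # xs) ! Suc i))"
      using False i by (intro Least_Suc[of _ "Suc i"]) auto
    then show ?thesis using returns_cost[OF IH] False
      by (intro returnsI) (simp add: pick_body_def returns_call[OF IH])
  qed
qed simp

lemma add_fn: "yields add_fn [num i, num j] (num (i + j)) (20 * i + 10)"
proof (induction i)
  case 0
  show ?case by (rule returnsI) (simp add: add_body_def)
next
  case (Suc i)
  show ?case using returns_cost[OF Suc.IH]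
    by (intro returnsI) (simp add: add_body_def returns_call[OF Suc.IH])
qed

lemma keys_fn: "yields keys_fn [enc_list (xs @ [y])] (enc_list (map (\<lambda>x. enc_bool (x \<noteq> Null)) xs)) (20 * length xs + 10)"
proof (induction xs)
  case Nil
  show ?case by (rule returnsI) (simp add: keys_body_def)
next
  case (Cons x xs)
  show ?case using returns_cost[OF Cons.IH]
    by (intro returnsI) (simp add: keys_body_def returns_call[OF Cons.IH] enc_bool_def)
qed

lemma init_fn: "yields init_fn [enc_list (map (\<lambda>v. enc_bool (v \<in> T)) [i..<i + m]),
    enc_list (map (\<lambda>v. enc_bool (v \<in> D)) [i..<i + m]), num i, num s, num n]
  (enc_list (map (\<lambda>v. num (if v \<in> D then s else if v \<in> T then n else v)) [i..<i + m])) (30 * m + 10)"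
proof (induction m arbitrary: i)
  case 0
  show ?case by (rule returnsI) (simp add: init_body_def)
next
  case (Suc m)
  note IH = Suc.IH[of "Suc i", unfolded num.simps add_Suc]
  have upt: "[i..<i + Suc m] = i # [Suc i..<Suc (i + m)]"
    by (simp add: upt_conv_Cons del: upt_Suc)
  show ?case using returns_cost[OF IH] unfolding upt
    by (intro returnsI) (simp add: init_body_def returns_call[OF IH] del: upt_Suc)
qed

section \<open>Correctness and cost of the program\<close>

lemma fold_const: "fold (\<lambda>_. f) xs a = (f ^^ length xs) a"
  by (induction xs arbitrary: a) (simp_all add: funpow_swap1)

definition enc_assignment :: "nat list \<Rightarrow> val" where
  "enc_assignment M = enc_list (map num M)"

definition enc_entry :: "nat list option \<Rightarrow> val" where
  "enc_entry w = (case w of None \<Rightarrow> Null | Some M \<Rightarrow> Cell Null (enc_assignment M))"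

definition enc_table :: "nat list option list \<Rightarrow> val" where
  "enc_table W = enc_list (map enc_entry W)"

lemma enc_entry_simps [simp]: "enc_entry None = Null" "enc_entry (Some M) = Cell Null (enc_assignment M)"
  by (simp_all add: enc_entry_def)

text \<open>A common cost bound for the operations that make a single pass over a list.\<close>

definition lin :: "nat \<Rightarrow> nat" where
  "lin n = 30 * n + 60"

text \<open>This bound and the next ones mirror the nesting of the loops; the constants are
  generous, as only polynomial growth matters in the end.\<close>

definition boundary_cost :: "nat \<Rightarrow> nat" where
  "boundary_cost n = n * (lin n + 40) + 2 * lin n + 40"

definition inner_cost :: "nat \<Rightarrow> nat" where
  "inner_cost n = n * (5 * lin n + 66) + 3"

definition outer_cost :: "nat \<Rightarrow> nat" where
  "outer_cost n = n * (2 * lin n + inner_cost n + 66) + 3"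

definition reach_cost :: "nat \<Rightarrow> nat" where
  "reach_cost n = n * (outer_cost n + 26) + lin n + 60"

definition augment_cost :: "nat \<Rightarrow> nat" where
  "augment_cost n = n * (reach_cost n + lin n + 46) + 3"

definition cut_cost :: "nat \<Rightarrow> nat" where
  "cut_cost n = reach_cost n + augment_cost n + 2 * lin n + 60"

definition cut_size_cost :: "nat \<Rightarrow> nat" where
  "cut_size_cost n = cut_cost n + boundary_cost n + lin n + 40"

section \<open>Computing one closest cut\<close>

context reflexive_graph
begin

definition enc_set :: "nat set \<Rightarrow> val" where
  "enc_set X = enc_list (map (\<lambda>v. enc_bool (v \<in> X)) [0..<n])"

definition enc_matrix :: val where
  "enc_matrix = enc_list (map (\<lambda>u. enc_set (nb u)) [0..<n])"

definition enc_vertices :: val where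
  "enc_vertices = enc_list (map num (rev [0..<n]))"

lemma nth_list:
  assumes "i < length xs" "i \<le> n"
  obtains d where "yields drop_fn [num i, enc_list xs] d (lin n)" "val_fst d = xs ! i"
  using that returns_mono[OF drop_fn[of i xs], of "lin n"] assms by (simp add: val_fst_enc_list lin_def)

lemma nth_set:
  assumes "i < n"
  obtains d where "yields drop_fn [num i, enc_set X] d (lin n)" "val_fst d = enc_bool (i \<in> X)"
  using nth_list[of i "map (\<lambda>v. enc_bool (v \<in> X)) [0..<n]"] assms unfolding enc_set_def by auto

lemma nth_matrix:
  assumes "i < n"
  obtains d where "yields drop_fn [num i, enc_matrix] d (lin n)" "val_fst d = enc_set (nb i)"
  using nth_list[of i "map (\<lambda>u. enc_set (nb u)) [0..<n]"] assms unfolding enc_matrix_def by auto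

lemma monus: "i \<le> n \<Longrightarrow> yields drop_fn [num i, num j] (num (j - i)) (lin n)"
  by (rule returns_mono[OF drop_fn_num]) (simp add: lin_def)

lemma union_set: "yields union_fn [enc_set X, enc_set Y] (enc_set (X \<union> Y)) (lin n)"
  using returns_mono[OF union_fn[of "\<lambda>v. v \<in> X" "[0..<n]" "\<lambda>v. v \<in> Y"], of "lin n"]
  by (simp add: enc_set_def lin_def)

lemma diff_set: "yields diff_fn [enc_set X, enc_set Y] (enc_set (X - Y)) (lin n)"
  using returns_mono[OF diff_fn[of "\<lambda>v. v \<in> X" "[0..<n]" "\<lambda>v. v \<in> Y"], of "lin n"]
  by (simp add: enc_set_def lin_def)

lemma insert_set:
  assumes "i < n"
  shows "yields update_fn [num i, enc_set X, Cell Null Null] (enc_set (insert i X)) (lin n)"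
proof -
  have "(map (\<lambda>v. enc_bool (v \<in> X)) [0..<n])[i := Cell Null Null] =
      map (\<lambda>v. enc_bool (v \<in> insert i X)) [0..<n]"
    using assms by (intro nth_equalityI) (auto simp: nth_list_update enc_bool_True)
  then show ?thesis
    using returns_mono[OF update_fn[of i "map (\<lambda>v. enc_bool (v \<in> X)) [0..<n]" "Cell Null Null"], of "lin n"]
      assms by (simp add: enc_set_def lin_def)
qed

lemma count_set:
  assumes "X \<subseteq> {..<n}"
  shows "yields count_fn [enc_set X, num j] (num (card X + j)) (lin n)"
proof -
  have "length (filter (\<lambda>v. v \<in> X) [0..<n]) = card (set (filter (\<lambda>v. v \<in> X) [0..<n]))"
    by (metis distinct_card distinct_filter distinct_upt)
  also have "set (filter (\<lambda>v. v \<in> X) [0..<n]) = X" using assms by auto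
  finally show ?thesis
    using returns_mono[OF count_fn[of "\<lambda>v. v \<in> X" "[0..<n]" j], of "lin n"] by (simp add: enc_set_def lin_def)
qed

lemma pick_set:
  assumes "X \<subseteq> {..<n}" "X \<noteq> {}"
  shows "yields pick_fn [enc_set X] (num (LEAST w. w \<in> X)) (lin n)"
proof -
  let ?w = "LEAST w. w \<in> X"
  have w: "?w \<in> X" using assms(2) by (metis LeastI ex_in_conv)
  then have wn: "?w < n" using assms(1) by auto
  have "(LEAST i. [0..<n] ! i \<in> X) = ?w"
  proof (rule Least_equality)
    show "[0..<n] ! ?w \<in> X" using w wn by simp
    show "?w \<le> y" if "[0..<n] ! y \<in> X" for y
      using that wn by (cases "y < n") (auto intro: Least_le)
  qed
  moreover have "\<exists>i<length [0..<n]. [0..<n] ! i \<in> X" using w wn by (intro exI[of _ ?w]) simp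
  ultimately show ?thesis
    using returns_mono[OF pick_fn[of "[0..<n]" "\<lambda>v. v \<in> X"], of "lin n"] by (simp add: enc_set_def lin_def)
qed

lemma closure_list:
  "yields closure_fn [enc_list (map (\<lambda>u. enc_bool (u \<in> X)) us), enc_list (map (\<lambda>u. enc_set (nb u)) us), enc_set A]
     (enc_set (A \<union> (\<Union>u\<in>set us \<inter> X. nb u))) (length us * ((lin n) + 40) + 10)"
proof (induction us arbitrary: A)
  case Nil
  show ?case by (rule returnsI) (simp add: closure_body_def)
next
  case (Cons u us)
  note IH1 = Cons.IH[of A] and IH2 = Cons.IH[of "A \<union> nb u"] and U = union_set[of A "nb u"]
  have *: "set (u # us) \<inter> X = (if u \<in> X then insert u (set us \<inter> X) else set us \<inter> X)" by auto
  have **: "A \<union> (\<Union>v\<in>insert u (set us \<inter> X). nb v) = A \<union> (nb u \<union> (\<Union>v\<in>set us \<inter> X. nb v))" by auto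
  show ?case unfolding * using returns_cost[OF IH1] returns_cost[OF IH2] returns_cost[OF U]
    by (intro returnsI)
      (simp add: closure_body_def returns_call[OF IH1] returns_call[OF IH2] returns_call[OF U] ** Un_assoc del: UN_insert)
qed

lemma boundary:
  assumes "X \<subseteq> {..<n}"
  shows "yields boundary_fn [enc_set X, enc_set D, enc_matrix] (enc_set (bd D X)) (boundary_cost n)"
proof -
  define C where "C = X \<union> (\<Union>u\<in>set [0..<n] \<inter> X. nb u)"
  have C: "yields closure_fn [enc_set X, enc_matrix, enc_set X] (enc_set C) (n * ((lin n) + 40) + 10)"
    using closure_list[of X "[0..<n]" X] by (simp add: C_def enc_set_def enc_matrix_def)
  have "C - X - D = bd D X" using assms by (auto simp: C_def bd_def cl_def nb_iff)
  then show ?thesis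
    using returns_cost[OF C] returns_cost[OF diff_set[of C X]] returns_cost[OF diff_set[of "C - X" D]]
    by (intro returnsI) (simp add: boundary_body_def returns_call[OF C] boundary_cost_def
        returns_call[OF diff_set[of C X]] returns_call[OF diff_set[of "C - X" D]])
qed

text \<open>Keeps indices in range, so that execution can be analysed apart from the combinatorial
  invariants in \<open>assignment\<close>.\<close>

definition valid_assignment :: "nat list \<Rightarrow> bool" where
  "valid_assignment M \<longleftrightarrow> length M = n \<and> (\<forall>v<n. M ! v \<le> n)"

definition valid_table :: "nat list option list \<Rightarrow> bool" where
  "valid_table W \<longleftrightarrow> length W = Suc n \<and> (\<forall>u\<le>n. \<forall>M. W ! u = Some M \<longrightarrow> valid_assignment M)"

lemma valid_tableD: "valid_table W \<Longrightarrow> u \<le> n \<Longrightarrow> W ! u = Some M \<Longrightarrow> valid_assignment M"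
  by (simp add: valid_table_def)

lemma inner:
  assumes M: "valid_assignment M" "valid_assignment M'" "u < n" and W: "valid_table W"
  shows "yields inner_fn [enc_vertices, enc_table W,
      Cell (Cell (num u) (enc_assignment M')) (Cell (enc_assignment M) (enc_set (nb u)))]
    (enc_table (fold (inner_step M u M') (rev [0..<n]) W)) (inner_cost n)"
    "valid_table (fold (inner_step M u M') (rev [0..<n]) W)"
proof -
  have step: "valid_table (inner_step M u M' v W) \<and>
     wp cut_program [Cell (num v) vs, enc_table W,
        Cell (Cell (num u) (enc_assignment M')) (Cell (enc_assignment M) (enc_set (nb u)))]
      (LetE (nthE (FstE (VarE 0)) (FstE (SndE (VarE 2))))
        (IfE (nthE (VarE 0) (VarE 2)) (VarE 2)
          (IfE (nthE (FstE (VarE 1)) (SndE (SndE (VarE 3))))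
            (CallE update_fn [VarE 0, VarE 2,
               CellE NullE (CallE update_fn [FstE (VarE 1), SndE (FstE (VarE 3)), FstE (FstE (VarE 3))])])
            (VarE 2))))
      (\<lambda>r c. r = enc_table (inner_step M u M' v W) \<and> c \<le> 5 * (lin n) + 60)"
    if v: "v < n" and W: "valid_table W" for v W vs
  proof -
    let ?m = "M ! v"
    have m: "?m \<le> n" "v < length M" "?m < length W" "v < length M'"
      using M v W by (auto simp: valid_assignment_def valid_table_def)
    obtain d1 where d1: "yields drop_fn [num v, enc_assignment M] d1 (lin n)" "val_fst d1 = num ?m"
      using nth_list[of v "map num M"] v m unfolding enc_assignment_def by auto
    obtain d2 where d2: "yields drop_fn [num ?m, enc_table W] d2 (lin n)" "val_fst d2 = enc_entry (W ! ?m)"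
      using nth_list[of ?m "map enc_entry W"] m unfolding enc_table_def by auto
    obtain d3 where d3: "yields drop_fn [num v, enc_set (nb u)] d3 (lin n)" "val_fst d3 = enc_bool (v \<in> nb u)"
      using nth_set[OF v] by blast
    let ?N = "M'[v := u]"
    have u1: "yields update_fn [num v, enc_assignment M', num u] (enc_assignment ?N) (lin n)"
      using returns_mono[OF update_fn[of v "map num M'" "num u"], of "lin n"] m v
      by (simp add: enc_assignment_def map_update lin_def)
    have u2: "yields update_fn [num ?m, enc_table W, Cell Null (enc_assignment ?N)]
        (enc_table (W[?m := Some ?N])) (lin n)"
      using returns_mono[OF update_fn[of ?m "map enc_entry W" "Cell Null (enc_assignment ?N)"], of "lin n"] m
      by (simp add: enc_table_def map_update lin_def)
    have "valid_assignment ?N"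
      using M v by (auto simp: valid_assignment_def nth_list_update)
    then have "valid_table (W[?m := Some ?N])"
      using W m by (auto simp: valid_table_def nth_list_update split: if_splits)
    moreover have "enc_entry (W ! ?m) = Null \<longleftrightarrow> W ! ?m = None" by (cases "W ! ?m") auto
    ultimately show ?thesis
      using W v returns_cost[OF d1(1)] returns_cost[OF d2(1)] returns_cost[OF d3(1)] returns_cost[OF u1] returns_cost[OF u2]
      by (simp add: returns_call[OF d1(1)] returns_call[OF d2(1)] returns_call[OF d3(1)] d1(2) d2(2) d3(2)
          returns_call[OF u1] returns_call[OF u2] inner_step_def nb_iff)
  qed
  have "yields inner_fn [enc_vertices, enc_table W,
      Cell (Cell (num u) (enc_assignment M')) (Cell (enc_assignment M) (enc_set (nb u)))]
    (enc_table (fold (inner_step M u M') (rev [0..<n]) W)) (length (rev [0..<n]) * (5 * (lin n) + 60 + 6) + 3)"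
    unfolding enc_vertices_def
    by (rule returns_fold[where I = valid_table and A = enc_table])
      (use step W in \<open>auto simp: inner_body_def\<close>)
  then show "yields inner_fn [enc_vertices, enc_table W,
      Cell (Cell (num u) (enc_assignment M')) (Cell (enc_assignment M) (enc_set (nb u)))]
    (enc_table (fold (inner_step M u M') (rev [0..<n]) W)) (inner_cost n)"
    by (rule returns_mono) (simp add: inner_cost_def algebra_simps)
  show "valid_table (fold (inner_step M u M') (rev [0..<n]) W)"
    by (rule fold_invariant[where Q = "\<lambda>v. v < n"]) (use step W in auto)
qed

lemma outer:
  assumes M: "valid_assignment M" and W: "valid_table W"
  shows "yields outer_fn [enc_vertices, enc_table W, Cell (enc_assignment M) (Cell enc_vertices enc_matrix)]
    (enc_table (round M W)) (outer_cost n)"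
    "valid_table (round M W)"
proof -
  let ?e = "Cell (enc_assignment M) (Cell enc_vertices enc_matrix)"
  have step: "valid_table (outer_step M u W) \<and>
     wp cut_program [Cell (num u) vs, enc_table W, ?e]
      (LetE (nthE (FstE (VarE 0)) (VarE 1))
       (IfE (VarE 0)
         (CallE inner_fn [FstE (SndE (VarE 3)), VarE 2,
            CellE (CellE (FstE (VarE 1)) (SndE (VarE 0)))
              (CellE (FstE (VarE 3)) (nthE (FstE (VarE 1)) (SndE (SndE (VarE 3)))))])
         (VarE 2)))
      (\<lambda>r c. r = enc_table (outer_step M u W) \<and> c \<le> 2 * (lin n) + (inner_cost n) + 60)"
    if u: "u < n" and W: "valid_table W" for u W vs
  proof -
    obtain d1 where d1: "yields drop_fn [num u, enc_table W] d1 (lin n)" "val_fst d1 = enc_entry (W ! u)"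
      using nth_list[of u "map enc_entry W"] W u unfolding enc_table_def by (auto simp: valid_table_def)
    obtain d2 where d2: "yields drop_fn [num u, enc_matrix] d2 (lin n)" "val_fst d2 = enc_set (nb u)"
      using nth_matrix[OF u] by blast
    show ?thesis
    proof (cases "W ! u")
      case None
      then show ?thesis using W returns_cost[OF d1(1)]
        by (simp add: returns_call[OF d1(1)] d1(2) outer_step_def)
    next
      case (Some M')
      then have M': "valid_assignment M'" using valid_tableD[OF W, of u] u by simp
      note inn = inner[OF M M' u W]
      show ?thesis using inn(2) returns_cost[OF inn(1)] returns_cost[OF d1(1)] returns_cost[OF d2(1)]
        by (simp add: returns_call[OF d1(1)] d1(2) returns_call[OF d2(1)] d2(2) Some outer_step_def
            returns_call[OF inn(1)])
    qed
  qed
  have "yields outer_fn [enc_vertices, enc_table W, ?e] (enc_table (fold (outer_step M) (rev [0..<n]) W))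
    (length (rev [0..<n]) * (2 * (lin n) + (inner_cost n) + 60 + 6) + 3)"
    unfolding enc_vertices_def
    by (rule returns_fold[where I = valid_table and A = enc_table])
      (use step W in \<open>auto simp: outer_body_def enc_vertices_def\<close>)
  then show "yields outer_fn [enc_vertices, enc_table W, ?e] (enc_table (round M W)) (outer_cost n)"
    unfolding round_def by (rule returns_mono) (simp add: outer_cost_def algebra_simps)
  show "valid_table (round M W)"
    unfolding round_def by (rule fold_invariant[where Q = "\<lambda>v. v < n"]) (use step W in auto)
qed

definition enc_context :: "nat \<Rightarrow> val" where
  "enc_context k = Cell (Cell enc_vertices enc_matrix) (Cell (num n) (num k))"

lemma reach_fn:
  assumes M: "valid_assignment M" and s: "s < n"
  shows "yields reach_fn [num s, enc_assignment M, enc_context k] (enc_table (reach s M)) (reach_cost n)"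
    "valid_table (reach s M)"
proof -
  let ?W = "(replicate (Suc n) None)[s := Some M]"
  let ?e = "Cell (enc_assignment M) (Cell enc_vertices enc_matrix)"
  have W: "valid_table ?W"
    using M s by (auto simp: valid_table_def nth_list_update simp del: replicate_Suc)
  have u: "yields update_fn [num s, num (Suc n), Cell Null (enc_assignment M)] (enc_table ?W) (lin n)"
    using returns_mono[OF update_fn[of s "replicate (Suc n) Null" "Cell Null (enc_assignment M)"], of "lin n"] s
    unfolding enc_list_Null by (simp add: enc_table_def map_update lin_def del: replicate_Suc num.simps)
  have "yields rounds_fn [enc_list (map num (rev [0..<n])), enc_table ?W, ?e]
      (enc_table (fold (\<lambda>_. round M) (rev [0..<n]) ?W)) (length (rev [0..<n]) * ((outer_cost n) + 20 + 6) + 3)"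
  proof (rule returns_fold[where I = valid_table and A = enc_table])
    fix v :: nat and vs W assume "valid_table W"
    note o = outer[OF M this]
    show "valid_table (round M W) \<and> wp cut_program [Cell (num v) vs, enc_table W, ?e]
        (CallE outer_fn [FstE (SndE (VarE 2)), VarE 1, VarE 2])
        (\<lambda>r c. r = enc_table (round M W) \<and> c \<le> (outer_cost n) + 20)"
      using o(2) returns_cost[OF o(1)] by (simp add: returns_call[OF o(1)])
  qed (use W in \<open>simp_all add: rounds_body_def\<close>)
  then have r: "yields rounds_fn [enc_vertices, enc_table ?W, ?e] (enc_table (reach s M)) (n * (26 + (outer_cost n)) + 3)"
    by (simp add: enc_vertices_def reach_def fold_const del: replicate_Suc)
  show "yields reach_fn [num s, enc_assignment M, enc_context k] (enc_table (reach s M)) (reach_cost n)"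
    using returns_cost[OF u] returns_cost[OF r]
    by (intro returnsI) (simp add: reach_body_def enc_context_def returns_call[OF u, unfolded num.simps]
        returns_call[OF r] reach_cost_def algebra_simps del: replicate_Suc)
  have "valid_table ((round M ^^ i) ?W)" for i
    by (induction i) (use W outer(2)[OF M] in auto)
  then show "valid_table (reach s M)" by (simp add: reach_def)
qed

lemma augment_fn:
  assumes M: "valid_assignment M" and s: "s < n"
  shows "yields augment_fn [enc_vertices, enc_assignment M, Cell (num s) (enc_context k)]
    (enc_assignment ((augment s ^^ n) M)) (augment_cost n)"
    "valid_assignment ((augment s ^^ n) M)"
proof -
  let ?e = "Cell (num s) (enc_context k)"
  have step: "valid_assignment (augment s M) \<and>
     wp cut_program [Cell (num v) vs, enc_assignment M, ?e]
      (LetE (nthE (orderE (SndE (VarE 2))) (CallE reach_fn [FstE (VarE 2), VarE 1, SndE (VarE 2)]))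
         (IfE (VarE 0) (SndE (VarE 0)) (VarE 2)))
      (\<lambda>r c. r = enc_assignment (augment s M) \<and> c \<le> (reach_cost n) + (lin n) + 40)"
    if M: "valid_assignment M" for v M vs
  proof -
    note r = reach_fn(1)[OF M s, of k] reach_fn(2)[OF M s]
    obtain d where d: "yields drop_fn [num n, enc_table (reach s M)] d (lin n)" "val_fst d = enc_entry (reach s M ! n)"
      using nth_list[of n "map enc_entry (reach s M)"] r(2) unfolding enc_table_def by (auto simp: valid_table_def)
    have "val_fst (val_snd (enc_context k)) = num n" by (simp add: enc_context_def)
    then show ?thesis using valid_tableD[OF r(2), of n] M returns_cost[OF r(1)] returns_cost[OF d(1)]
      by (cases "reach s M ! n")
        (simp_all add: returns_call[OF r(1)] returns_call[OF d(1)] d(2) augment_def)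
  qed
  have "yields augment_fn [enc_vertices, enc_assignment M, ?e]
      (enc_assignment (fold (\<lambda>_. augment s) (rev [0..<n]) M)) (length (rev [0..<n]) * ((reach_cost n) + (lin n) + 40 + 6) + 3)"
    unfolding enc_vertices_def
    by (rule returns_fold[where I = valid_assignment and A = enc_assignment])
      (use step M in \<open>auto simp: augment_body_def\<close>)
  then show "yields augment_fn [enc_vertices, enc_assignment M, ?e] (enc_assignment ((augment s ^^ n) M)) (augment_cost n)"
    by (simp add: fold_const augment_cost_def ac_simps)
  have "valid_assignment ((augment s ^^ i) M)" for i
    by (induction i) (use M step in auto)
  then show "valid_assignment ((augment s ^^ n) M)" .
qed

lemma cut_fn:
  assumes s: "s < n"
  shows "yields cut_fn [num s, enc_set T, enc_set D, enc_context k] (enc_set (cut s T D)) (cut_cost n)"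
proof -
  let ?M = "map (init_owner s T D) [0..<n]" let ?A = "max_assignment s T D"
  have M: "valid_assignment ?M" using s by (auto simp: valid_assignment_def init_owner_def)
  have i: "yields init_fn [enc_set T, enc_set D, Null, num s, num n] (enc_assignment ?M) (lin n)"
    using returns_mono[OF init_fn[of T 0 n D s n], of "lin n"]
    by (simp add: enc_set_def enc_assignment_def init_owner_def lin_def comp_def)
  note a = augment_fn(1)[OF M s, of k, folded max_assignment_def]
    augment_fn(2)[OF M s, folded max_assignment_def]
  note r = reach_fn(1)[OF a(2) s, of k] reach_fn(2)[OF a(2) s]
  let ?W = "reach s ?A"
  have len: "length ?W = Suc n" using r(2) by (simp add: valid_table_def)
  have "?W = take n ?W @ [?W ! n]" using len by (metis lessI take_Suc_conv_app_nth take_all order_refl)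
  then have split: "enc_table ?W = enc_list (map enc_entry (take n ?W) @ [enc_entry (?W ! n)])"
    unfolding enc_table_def by (metis map_append list.simps(8,9))
  have "map (\<lambda>x. enc_bool (x \<noteq> Null)) (map enc_entry (take n ?W)) = map (\<lambda>v. enc_bool (v \<in> cut s T D)) [0..<n]"
    using len by (intro nth_equalityI) (auto simp: cut_def cut_of_def enc_entry_def split: option.splits)
  then have k: "yields keys_fn [enc_table ?W] (enc_set (cut s T D)) (lin n)"
    using returns_mono[OF keys_fn[of "map enc_entry (take n ?W)" "enc_entry (?W ! n)"], of "lin n"] len
    unfolding split enc_set_def by (simp add: lin_def)
  have e: "val_fst (val_fst (enc_context k)) = enc_vertices" "val_fst (val_snd (enc_context k)) = num n"
    by (simp_all add: enc_context_def)
  show ?thesis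
    using returns_cost[OF i] returns_cost[OF a(1)] returns_cost[OF r(1)] returns_cost[OF k]
    by (intro returnsI) (simp add: cut_body_def e cut_cost_def returns_call[OF i] returns_call[OF a(1)]
        returns_call[OF r(1)] returns_call[OF k])
qed

lemma cut_less: "cut s T D \<subseteq> {..<n}"
  by (auto simp: cut_def cut_of_def)

lemma cut_size_fn:
  assumes s: "s < n"
  shows "yields cut_size_fn [num s, enc_set T, enc_set D, enc_context k] (num (cut_size s T D)) (cut_size_cost n)"
proof -
  note c = cut_fn[OF s, of T D k] and b = boundary[OF cut_less[of s T D], of D]
  note n = count_set[OF bd_less[of D "cut s T D"], of 0]
  have e: "val_snd (val_fst (enc_context k)) = enc_matrix" by (simp add: enc_context_def)
  show ?thesis using returns_cost[OF c] returns_cost[OF b] returns_cost[OF n]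
    by (intro returnsI) (simp add: cut_size_body_def e cut_size_cost_def returns_call[OF c] returns_call[OF b]
        returns_call[OF n, simplified] cut_size_def)
qed

end

section \<open>Cost of the two searches\<close>

definition best_cost :: "nat \<Rightarrow> nat" where
  "best_cost n = n * (cut_size_cost n + 7 * lin n + 106) + 3"

primrec branching_cost :: "nat \<Rightarrow> nat \<Rightarrow> nat" where
  "branching_cost q 0 = q"
| "branching_cost q (Suc m) = 2 * branching_cost q m + q"

definition solve_step_cost :: "nat \<Rightarrow> nat" where
  "solve_step_cost n = cut_cost n + boundary_cost n + best_cost n + 12 * lin n + 300"

definition enum_step_cost :: "nat \<Rightarrow> nat" where
  "enum_step_cost n = boundary_cost n + 12 * lin n + 300"

lemma branching_cost: "branching_cost q m + q = q * 2 ^ Suc m"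
  by (induction m) (simp_all add: algebra_simps)

lemma fold_or: "fold (\<lambda>x b. b \<or> P x) xs a \<longleftrightarrow> a \<or> (\<exists>x\<in>set xs. P x)"
  by (induction xs arbitrary: a) auto

context reflexive_graph
begin

lemma enc_context_simps [simp]:
  "val_fst (val_fst (enc_context k)) = enc_vertices" "val_snd (val_fst (enc_context k)) = enc_matrix"
  "val_fst (val_snd (enc_context k)) = num n" "val_snd (val_snd (enc_context k)) = num k"
  by (simp_all add: enc_context_def)

lemma best_fn:
  assumes s: "s < n"
  shows "yields best_fn [enc_vertices, Cell (Cell Null (num n)) (num s),
      Cell (Cell (num s) (enc_set Z)) (Cell (Cell (enc_set T) (enc_set D)) (enc_context k))]
    (Cell (num (fst (best s T D Z))) (num (snd (best s T D Z)))) (best_cost n)"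
proof -
  let ?e = "Cell (Cell (num s) (enc_set Z)) (Cell (Cell (enc_set T) (enc_set D)) (enc_context k))"
  let ?A = "\<lambda>a. Cell (num (fst a)) (num (snd a))"
  obtain step where step: "best_body = fold_body best_fn step" by (simp add: best_body_def)
  have wp: "wp cut_program [Cell (num v) vs, ?A a, ?e] step
      (\<lambda>r c. r = ?A (best_step s T D Z v a) \<and> c \<le> cut_size_cost n + 7 * lin n + 100)"
    if v: "v < n" for v a vs
  proof -
    obtain d1 where d1: "yields drop_fn [num v, enc_set Z] d1 (lin n)" "val_fst d1 = enc_bool (v \<in> Z)"
      using nth_set[OF v] by blast
    obtain d2 where d2: "yields drop_fn [num s, enc_matrix] d2 (lin n)" "val_fst d2 = enc_set (nb s)"
      using nth_matrix[OF s] by blast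
    obtain d3 where d3: "yields drop_fn [num v, enc_set (nb s)] d3 (lin n)" "val_fst d3 = enc_bool (v \<in> nb s)"
      using nth_set[OF v] by blast
    obtain d4 where d4: "yields drop_fn [num v, enc_matrix] d4 (lin n)" "val_fst d4 = enc_set (nb v)"
      using nth_matrix[OF v] by blast
    note u = union_set[of T "nb v"] and c = cut_size_fn[OF s, of "T \<union> nb v" D k]
    let ?l = "cut_size s (T \<union> nb v) D"
    have "?l \<le> n" using card_mono[OF _ bd_less[of D "cut s (T \<union> nb v) D"]] by (simp add: cut_size_def)
    note m = monus[OF this, of "fst a"]
    show ?thesis
      using step[unfolded best_body_def fold_body_def, symmetric] v
        returns_cost[OF d1(1)] returns_cost[OF d2(1)] returns_cost[OF d3(1)] returns_cost[OF d4(1)]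
        returns_cost[OF u] returns_cost[OF c] returns_cost[OF m]
      by (simp add: returns_call[OF d1(1)] returns_call[OF d2(1)] returns_call[OF d3(1)]
          returns_call[OF d4(1)] returns_call[OF u] returns_call[OF c] returns_call[OF m]
          d1(2) d2(2) d3(2) d4(2) best_step_def nb_iff)
  qed
  have "yields best_fn [enc_vertices, ?A (Suc n, s), ?e]
      (?A (fold (best_step s T D Z) (rev [0..<n]) (Suc n, s)))
      (length (rev [0..<n]) * (cut_size_cost n + 7 * lin n + 100 + 6) + 3)"
    unfolding enc_vertices_def
    by (rule returns_fold[where I = "\<lambda>_. True" and A = ?A]) (use wp step in auto)
  then show ?thesis by (simp add: best_def[symmetric] best_cost_def ac_simps)
qed

lemma best_less: "s < n \<Longrightarrow> snd (best s T D Z) < n"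
  by (cases rule: best[of s T D Z]) auto

lemma solve_fn:
  assumes s: "s < n" and k: "k \<le> n" and "t \<le> n"
  shows "yields solve_fn [num m, num s, enc_set T, enc_set D, num t, enc_context k]
    (enc_bool (solve k m s T D t)) (branching_cost (solve_step_cost n) m)"
  using assms(3)
proof (induction m arbitrary: T D t)
  case 0
  show ?case by (rule returnsI) (simp add: solve_body_def solve_step_cost_def)
next
  case (Suc m)
  let ?X = "cut s T D"
  define B where "B = bd D ?X"
  define l where "l = card B"
  have Bn: "B \<subseteq> {..<n}" by (simp add: B_def bd_less)
  let ?w = "LEAST w. w \<in> B"
  let ?a = "best s T D ?X" let ?v = "snd ?a" let ?q = "branching_cost (solve_step_cost n) m"
  note c = cut_fn[OF s, of T D k] and b = boundary[OF cut_less[of s T D], of D, folded B_def]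
  note cl = count_set[OF Bn, of 0, folded l_def, simplified]
  note x = count_set[OF cut_less[of s T D], of l]
  note m1 = monus[OF Suc.prems, of l] and m2 = monus[OF Suc.prems, of "card ?X + l"]
  note m3 = monus[OF k, of "card ?X + l - t"]
  note calls = returns_call[OF c] returns_call[OF b] returns_call[OF cl] returns_call[OF x]
    returns_call[OF m1] returns_call[OF m2] returns_call[OF m3]
  note costs = returns_cost[OF c] returns_cost[OF b] returns_cost[OF cl] returns_cost[OF x]
    returns_cost[OF m1] returns_cost[OF m2] returns_cost[OF m3]
  have sol: "solve k (Suc m) s T D t =
     (if t < l then False else if card ?X + l \<le> k + t then True
      else if l = 0 then (if fst ?a \<le> t then solve k m s (T \<union> nb ?v) D t else False)
      else solve k m s (insert ?w T) (insert ?w D) (t - 1) \<or> (\<not> R s ?w \<and> solve k m s (T \<union> nb ?w) D t))"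
    by (simp add: solve.simps(2) Let_def B_def l_def)
  show ?case
  proof (cases "t < l \<or> card ?X + l \<le> k + t")
    case True
    then show ?thesis using costs
      by (intro returnsI) (auto simp add: solve_body_def calls sol solve_step_cost_def enc_bool_True)
  next
    case no: False
    show ?thesis
    proof (cases "l = 0")
      case True
      note a = best_fn[OF s, of ?X T D k] and m4 = monus[OF Suc.prems, of "fst ?a"]
      have v: "?v < n" using s by (rule best_less)
      obtain d where d: "yields drop_fn [num ?v, enc_matrix] d (lin n)" "val_fst d = enc_set (nb ?v)"
        using nth_matrix[OF v] by blast
      note u = union_set[of T "nb ?v"] and IH = Suc.IH[OF Suc.prems, of "T \<union> nb ?v" D]
      show ?thesis
        using no True costs returns_cost[OF a] returns_cost[OF m4] returns_cost[OF d(1)]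
          returns_cost[OF u] returns_cost[OF IH]
        by (intro returnsI) (simp add: solve_body_def calls calls[simplified True, simplified] sol
            solve_step_cost_def enc_bool_True returns_call[OF a] returns_call[OF m4] returns_call[OF d(1)] d(2) returns_call[OF u]
            returns_call[OF IH])
    next
      case False
      then have "?w \<in> B" by (intro Least_in) (simp add: l_def)
      then have w: "?w < n" and B: "B \<noteq> {}" using Bn by auto
      note p = pick_set[OF Bn B] and i1 = insert_set[OF w, of T] and i2 = insert_set[OF w, of D]
      obtain d1 where d1: "yields drop_fn [num s, enc_matrix] d1 (lin n)" "val_fst d1 = enc_set (nb s)"
        using nth_matrix[OF s] by blast
      obtain d2 where d2: "yields drop_fn [num ?w, enc_set (nb s)] d2 (lin n)" "val_fst d2 = enc_bool (?w \<in> nb s)"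
        using nth_set[OF w] by blast
      obtain d3 where d3: "yields drop_fn [num ?w, enc_matrix] d3 (lin n)" "val_fst d3 = enc_set (nb ?w)"
        using nth_matrix[OF w] by blast
      have t1: "t - 1 \<le> n" using Suc.prems by simp
      note u = union_set[of T "nb ?w"]
      note IH1 = Suc.IH[OF t1, of "insert ?w T" "insert ?w D"] and IH2 = Suc.IH[OF Suc.prems, of "T \<union> nb ?w" D]
      have sol': "solve k (Suc m) s T D t \<longleftrightarrow> solve k m s (insert ?w T) (insert ?w D) (t - 1) \<or>
          (\<not> R s ?w \<and> solve k m s (T \<union> nb ?w) D t)"
        unfolding sol using no False by simp
      have nbw: "?w \<in> nb s \<longleftrightarrow> R s ?w" using w by (simp add: nb_iff)
      note calls' = returns_call[OF p] returns_call[OF i1] returns_call[OF i2] returns_call[OF d1(1)]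
        returns_call[OF d2(1)] returns_call[OF d3(1)] returns_call[OF u]
        returns_call[OF IH1] returns_call[OF IH2]
      show ?thesis unfolding sol'
        using no False costs returns_cost[OF p] returns_cost[OF i1] returns_cost[OF i2]
          returns_cost[OF d1(1)] returns_cost[OF d2(1)] returns_cost[OF d3(1)] returns_cost[OF u]
          returns_cost[OF IH1] returns_cost[OF IH2]
        by (intro returnsI) (simp add: solve_body_def calls solve_step_cost_def enc_bool_True
            calls' calls'[simplified] d1(2) d2(2) d3(2) nbw)
    qed
  qed
qed

lemma enum_fn:
  assumes k: "k \<le> n" and "t \<le> n" "A \<subseteq> {..<n}"
  shows "yields enum_fn [num m, enc_set A, enc_set D, num t, enc_context k]
    (enc_bool (enum k m A D t)) (branching_cost (enum_step_cost n) m)"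
  using assms(2-)
proof (induction m arbitrary: A D t)
  case 0
  show ?case by (rule returnsI) (simp add: enum_body_def enum_step_cost_def)
next
  case (Suc m)
  let ?B = "bd D A" let ?w = "LEAST w. w \<in> ?B"
  note b = boundary[OF Suc.prems(2), of D] and l = count_set[OF bd_less[of D A], of 0, simplified]
  note m1 = monus[OF Suc.prems(1), of "card ?B"]
  note x = count_set[OF Suc.prems(2), of 0, simplified] and m2 = monus[OF k, of "card A"]
  note calls = returns_call[OF b] returns_call[OF l] returns_call[OF m1] returns_call[OF x] returns_call[OF m2]
  note costs = returns_cost[OF b] returns_cost[OF l] returns_cost[OF m1] returns_cost[OF x] returns_cost[OF m2]
  have en: "enum k (Suc m) A D t = (if card ?B \<le> t then card A \<le> k
      else enum k m (insert ?w A) D t \<or> (0 < t \<and> enum k m A (insert ?w D) (t - 1)))"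
    by (simp add: enum.simps(2) Let_def)
  show ?case
  proof (cases "card ?B \<le> t")
    case True
    then show ?thesis using costs
      by (intro returnsI) (auto simp add: enum_body_def calls en enum_step_cost_def enc_bool_True)
  next
    case False
    then have B: "?B \<noteq> {}" by auto
    have "?w \<in> ?B" using False by (intro Least_in) auto
    then have w: "?w < n" using bd_less by auto
    note p = pick_set[OF bd_less B] and i1 = insert_set[OF w, of A] and i2 = insert_set[OF w, of D]
    have t1: "t - 1 \<le> n" and A1: "insert ?w A \<subseteq> {..<n}" using Suc.prems w by auto
    note IH1 = Suc.IH[OF Suc.prems(1) A1, of D] and IH2 = Suc.IH[OF t1 Suc.prems(2), of "insert ?w D"]
    note calls' = returns_call[OF p] returns_call[OF i1] returns_call[OF i2]
      returns_call[OF IH1] returns_call[OF IH2]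
    show ?thesis
      using False costs returns_cost[OF p] returns_cost[OF i1] returns_cost[OF i2]
        returns_cost[OF IH1] returns_cost[OF IH2]
      by (intro returnsI) (simp add: enum_body_def calls en enum_step_cost_def enc_bool_True
          calls' calls'[simplified], auto)
  qed
qed

end

section \<open>Reading the input, and the main function\<close>

definition seed_cost :: "nat \<Rightarrow> nat \<Rightarrow> nat" where
  "seed_cost n m = branching_cost (enum_step_cost n) m + branching_cost (solve_step_cost n) m + lin n + 100"

definition total_cost :: "nat \<Rightarrow> nat \<Rightarrow> nat" where
  "total_cost n m = n * (seed_cost n m + 6) + 2 * (n * (60 * n + 120) + 20) + n * (lin n + 50) + 100 * n + 400"

lemma numeral_fn:
  "yields numeral_fn [enc_list (map enc_bool (bits m)), num f, num n]
     (num (if m < 2 ^ f then min m n else n)) (f * (60 * n + 120) + 20)"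
proof (induction f arbitrary: m)
  case 0
  have "bits m = [] \<longleftrightarrow> m = 0" by (subst bits.simps) simp
  then show ?case by (intro returnsI) (simp add: numeral_body_def)
next
  case (Suc f)
  show ?case
  proof (cases "m = 0")
    case True
    then have "bits m = []" by (subst bits.simps) simp
    then show ?thesis using True by (intro returnsI) (simp add: numeral_body_def)
  next
    case False
    then have bits: "bits m = odd m # bits (m div 2)" by (subst bits.simps) simp
    \<comment> \<open>Doubling by subtraction: \<open>v\<close> is the capped value of the upper
      digits and \<open>x\<close> is \<open>n\<close> minus the low bit, so
      \<open>n - ((x - v) - v)\<close> is \<open>2 * v\<close> plus the low bit, and truncation caps
      it at \<open>n\<close>.\<close>
    define v where "v = (if m div 2 < 2 ^ f then min (m div 2) n else n)"
    define x where "x = (if odd m then n - 1 else n)"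
    define y where "y = x - v"
    define z where "z = y - v"
    have le: "20 * v + 10 \<le> 20 * n + 10" "20 * z + 10 \<le> 20 * n + 10"
      by (auto simp: v_def x_def y_def z_def)
    have res: "n - z = (if m < 2 ^ Suc f then min m n else n)"
    proof (cases "odd m")
      case True
      then obtain h where "m = 2 * h + 1" by (elim oddE)
      moreover from this have "m div 2 = h" by simp
      ultimately show ?thesis by (auto simp: v_def x_def y_def z_def min_def)
    next
      case False
      then obtain h where "m = 2 * h" by (auto elim: evenE)
      moreover from this have "m div 2 = h" by simp
      ultimately show ?thesis by (auto simp: v_def x_def y_def z_def min_def)
    qed
    note IH = Suc.IH[of "m div 2", folded v_def]
    note d1 = drop_fn_num[of v x, folded y_def] and d2 = drop_fn_num[of v y, folded z_def]
      and d3 = drop_fn_num[of z n]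
    have x: "odd m \<Longrightarrow> val_snd (num n) = num x" "even m \<Longrightarrow> num n = num x" by (auto simp: x_def)
    note costs = returns_cost[OF IH] returns_cost[OF d1] returns_cost[OF d2] returns_cost[OF d3] le
    have "yields numeral_fn [enc_list (map enc_bool (bits m)), num (Suc f), num n] (num (n - z))
        (Suc f * (60 * n + 120) + 20)"
    proof (cases "odd m")
      case True
      show ?thesis using costs True
        by (intro returnsI) (simp add: numeral_body_def bits x(1)[OF True] returns_call[OF IH]
            returns_call[OF d1] returns_call[OF d2] returns_call[OF d3] del: val_snd_num)
    next
      case False
      note d1' = d1[folded x(2)[OF False[unfolded not_not]]]
      show ?thesis using costs False returns_cost[OF d1']
        by (intro returnsI) (simp add: numeral_body_def bits returns_call[OF IH]
            returns_call[OF d1'] returns_call[OF d2] returns_call[OF d3])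
    qed
    then show ?thesis unfolding res .
  qed
qed

text \<open>A number with more than \<open>n\<close> digits is at least \<open>2 ^ n > n\<close> and
  would be capped anyway, so the cost is independent of the length of the input number.\<close>

lemma numeral_fn_min:
  "yields numeral_fn [enc_nat m, num n, num n] (num (min m n)) (n * (60 * n + 120) + 20)"
proof -
  have "n < 2 ^ n" by (rule less_exp)
  then have "m < 2 ^ n \<or> n < m" by linarith
  then have "(if m < 2 ^ n then min m n else n) = min m n" by auto
  then show ?thesis using numeral_fn[of m n n] by (simp add: enc_nat_def)
qed

lemma vertices_fn:
  "yields vertices_fn [enc_list xs, num i, enc_list (map num (rev [0..<i]))]
     (Cell (num (i + length xs)) (enc_list (map num (rev [0..<i + length xs])))) (20 * length xs + 10)"
proof (induction xs arbitrary: i)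
  case Nil
  show ?case by (rule returnsI) (simp add: vertices_body_def)
next
  case (Cons x xs)
  note IH = Cons.IH[of "Suc i", simplified]
  show ?case using returns_cost[OF IH]
    by (intro returnsI) (simp add: vertices_body_def returns_call[OF IH])
qed

context reflexive_graph
begin

lemma any_fn:
  assumes k: "k \<le> n" and t: "t \<le> n"
  shows "yields any_fn [enc_vertices, Null, Cell (num (Suc (t + t))) (Cell (num t) (enc_context k))]
    (enc_bool (decide k t)) (n * (seed_cost n (Suc (t + t)) + 6) + 3)"
proof -
  let ?m = "Suc (t + t)"
  let ?e = "Cell (num ?m) (Cell (num t) (enc_context k))"
  let ?P = "\<lambda>s. enum k ?m {s} {} t \<or> solve k ?m s {} {} t"
  have empty: "num n = enc_set {}"
    by (simp add: enc_set_def map_replicate_const enc_list_Null)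
  obtain step where step: "any_body = fold_body any_fn step" by (simp add: any_body_def)
  have wp: "wp cut_program [Cell (num s) vs, enc_bool b, ?e] step
      (\<lambda>r c. r = enc_bool (b \<or> ?P s) \<and> c \<le> seed_cost n ?m)" if s: "s < n" for s b vs
  proof -
    have "{s} \<subseteq> {..<n}" using s by simp
    note i = insert_set[OF s, of "{}", folded empty]
      and e = enum_fn[OF k t this, of ?m "{}", folded empty]
      and v = solve_fn[OF s k t, of ?m "{}" "{}", folded empty]
    show ?thesis
      using step[unfolded any_body_def fold_body_def, symmetric]
        returns_cost[OF i] returns_cost[OF e] returns_cost[OF v]
      by (cases b; cases "enum k ?m {s} {} t")
        (simp_all add: returns_call[OF i] returns_call[OF e] returns_call[OF v] enc_bool_True
          seed_cost_def del: num.simps enum.simps solve.simps branching_cost.simps)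
  qed
  have "yields any_fn [enc_vertices, enc_bool False, ?e]
      (enc_bool (fold (\<lambda>s b. b \<or> ?P s) (rev [0..<n]) False)) (length (rev [0..<n]) * (seed_cost n ?m + 6) + 3)"
    unfolding enc_vertices_def
    by (rule returns_fold[where I = "\<lambda>_. True" and A = enc_bool]) (use wp step in auto)
  then show ?thesis unfolding fold_or by (simp add: decide_def Bex_def atLeast0LessThan del: num.simps)
qed

lemma reflexive_fn:
  assumes "\<And>u v. u < n \<Longrightarrow> v < n \<Longrightarrow> R u v \<longleftrightarrow> u = v \<or> E u v" and "i + m \<le> n"
  shows "yields reflexive_fn [enc_list (map (\<lambda>u. enc_set {v. E u v}) [i..<i + m]), num i]
    (enc_list (map (\<lambda>u. enc_set (nb u)) [i..<i + m])) (m * (lin n + 50) + 10)"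
  using assms(2)
proof (induction m arbitrary: i)
  case 0
  show ?case by (rule returnsI) (simp add: reflexive_body_def)
next
  case (Suc m)
  have "Suc i + m \<le> n" and i: "i < n" using Suc.prems by auto
  note IH = Suc.IH[OF this(1), unfolded num.simps add_Suc]
  have upt: "[i..<i + Suc m] = i # [Suc i..<Suc (i + m)]"
    by (simp add: upt_conv_Cons del: upt_Suc)
  have "enc_set (insert i {v. E i v}) = enc_set (nb i)"
    unfolding enc_set_def
    by (intro arg_cong[of _ _ enc_list] map_cong refl arg_cong[of _ _ enc_bool])
      (use assms(1)[OF i] in \<open>auto simp: nb_iff\<close>)
  note u = insert_set[OF i, of "{v. E i v}", unfolded this]
  show ?case using returns_cost[OF IH] returns_cost[OF u] unfolding upt
    by (intro returnsI) (simp add: reflexive_body_def returns_call[OF IH] returns_call[OF u] del: upt_Suc)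
qed

lemma main_fn:
  assumes E: "\<And>u v. u < n \<Longrightarrow> v < n \<Longrightarrow> R u v \<longleftrightarrow> u = v \<or> E u v"
  defines "g \<equiv> enc_list (map (\<lambda>u. enc_set {v. E u v}) [0..<n])"
  shows "yields main_fn [Cell g (Cell (enc_nat k) (enc_nat t))]
    (enc_bool (decide (min k n) (min t n))) (total_cost n (Suc (min t n + min t n)))"
proof -
  let ?t = "min t n" and ?k = "min k n"
  have v: "yields vertices_fn [g, Null, Null] (Cell (num n) enc_vertices) (20 * n + 10)"
    using vertices_fn[of "map (\<lambda>u. enc_set {v. E u v}) [0..<n]" 0] by (simp add: g_def enc_vertices_def)
  have r: "yields reflexive_fn [g, Null] enc_matrix (n * (lin n + 50) + 10)"
    using reflexive_fn[of E 0 n, OF E] by (simp add: g_def enc_matrix_def)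
  note k = numeral_fn_min[of k n] and t = numeral_fn_min[of t n]
  have ad: "yields add_fn [num ?t, num ?t] (num (?t + ?t)) (20 * n + 10)"
    by (rule returns_mono[OF add_fn]) simp
  note an = any_fn[of ?k ?t, unfolded num.simps enc_context_def]
  have an: "yields any_fn [enc_vertices, Null, Cell (Cell Null (num (?t + ?t)))
      (Cell (num ?t) (Cell (Cell enc_vertices enc_matrix) (Cell (num n) (num ?k))))]
    (enc_bool (decide ?k ?t)) (n * (seed_cost n (Suc (?t + ?t)) + 6) + 3)"
    by (rule an) simp_all
  show ?thesis
    using returns_cost[OF v] returns_cost[OF r] returns_cost[OF k] returns_cost[OF t] returns_cost[OF ad] returns_cost[OF an]
    by (intro returnsI) (simp add: main_body_def returns_call[OF v] returns_call[OF r] returns_call[OF k] returns_call[OF t]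
        returns_call[OF ad] returns_call[OF an] total_cost_def)
qed

text \<open>Neither a vertex set nor its boundary has more than \<open>n\<close> elements. The empty
  graph is separate because there \<open>min k n\<close> falls below 1.\<close>

lemma decide_min_iff:
  assumes "k \<ge> 1"
  shows "decide (min k n) (min t n) \<longleftrightarrow> (\<exists>X. solution k t X)"
proof (cases "n = 0")
  case True
  then have "\<not> decide (min k n) (min t n)" unfolding decide_def by simp
  moreover have "\<not> solution k t X" for X using True unfolding solution_def by auto
  ultimately show ?thesis by blast
next
  case False
  have "X \<subseteq> {..<n} \<Longrightarrow> card X \<le> n" for X using card_mono[of "{..<n}" X] by simp
  then have "solution (min k n) (min t n) X \<longleftrightarrow> solution k t X" for X
    using bd_less[of "{}" X] by (auto simp: solution_def)
  then show ?thesis using decide_iff[of "min t n" "min k n"] assms False by simp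
qed

end

section \<open>Transfer from numbered vertices to graphs\<close>

lemma solution_iff_cutting:
  assumes G: "pair_graph G" and vs: "distinct vs" "set vs = pverts G"
  defines "R \<equiv> \<lambda>i j. i = j \<or> i < length vs \<and> j < length vs \<and> (vs ! i, vs ! j) \<in> parcs G"
  shows "(\<exists>X. reflexive_graph.solution (length vs) R k t X) \<longleftrightarrow> cutting_at_most_k_vertices (G, k, t)"
    "reflexive_graph R"
proof -
  interpret pair_graph G by (rule G)
  have R_iff: "R i j \<longleftrightarrow> i = j \<or> i < length vs \<and> j < length vs \<and> (vs ! i, vs ! j) \<in> parcs G" for i j
    by (simp add: R_def)
  have sym: "(v, u) \<in> parcs G" if "(u, v) \<in> parcs G" for u v
    using that arcs_symmetric by simp
  \<comment> \<open>Reflexivity is demanded of all numbers, so \<open>R\<close> relates even indices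
    beyond the list to themselves.\<close>
  show refl: "reflexive_graph R"
    by unfold_locales (auto simp: R_iff intro: sym)
  then interpret C: reflexive_graph "length vs" R .
  let ?f = "(!) vs"
  have inj: "inj_on ?f {..<length vs}" using vs(1) by (auto simp: inj_on_def nth_eq_iff_index_eq)
  have img: "?f ` {..<length vs} = pverts G" using vs(2) by (auto simp: set_conv_nth)
  have nb: "card (open_neighborhood G (?f ` X)) = card (C.bd {} X)" if X: "X \<subseteq> {..<length vs}" for X
  proof -
    have "open_neighborhood G (?f ` X) = ?f ` C.bd {} X"
    proof (intro equalityI subsetI)
      fix w assume w: "w \<in> open_neighborhood G (?f ` X)"
      then obtain u where u: "u \<in> X" "(?f u, w) \<in> parcs G" "w \<notin> ?f ` X" by (auto simp: open_neighborhood_def)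
      then have "w \<in> pverts G" using head_in_verts[of "(?f u, w)"] by simp
      then obtain j where j: "j < length vs" "w = ?f j" using img by auto
      then have "j \<in> C.bd {} X" using u X by (auto simp: C.bd_def C.cl_def R_iff)
      then show "w \<in> ?f ` C.bd {} X" using j by blast
    next
      fix w assume "w \<in> ?f ` C.bd {} X"
      then obtain j where j: "j \<in> C.bd {} X" "w = ?f j" by blast
      then obtain u where u: "u \<in> X" "R u j" "j \<notin> X" "j < length vs" by (auto simp: C.bd_def C.cl_def)
      then have "(?f u, w) \<in> parcs G" using j by (auto simp: R_iff)
      moreover have "w \<notin> ?f ` X"
        using u X j(2) inj by (metis inj_on_image_mem_iff lessThan_iff)
      ultimately show "w \<in> open_neighborhood G (?f ` X)" using u by (auto simp: open_neighborhood_def)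
    qed
    moreover have "inj_on ?f (C.bd {} X)" using inj C.bd_less by (rule inj_on_subset)
    ultimately show ?thesis by (simp add: card_image)
  qed
  have card: "card (?f ` X) = card X" if "X \<subseteq> {..<length vs}" for X
    using inj_on_subset[OF inj that] by (rule card_image)
  show "(\<exists>X. C.solution k t X) \<longleftrightarrow> cutting_at_most_k_vertices (G, k, t)"
  proof
    assume "\<exists>X. C.solution k t X"
    then obtain X where X: "X \<noteq> {}" "X \<subseteq> {..<length vs}" "card X \<le> k" "card (C.bd {} X) \<le> t"
      by (auto simp: C.solution_def)
    then show "cutting_at_most_k_vertices (G, k, t)"
      using img by (auto simp: nb card intro!: exI[of _ "?f ` X"])
  next
    assume "cutting_at_most_k_vertices (G, k, t)"
    then obtain Y where Y: "Y \<noteq> {}" "Y \<subseteq> pverts G" "card Y \<le> k" "card (open_neighborhood G Y) \<le> t"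
      by auto
    then obtain X where X: "X \<subseteq> {..<length vs}" "Y = ?f ` X" using img by (metis subset_imageE)
    then have "C.solution k t X" using Y nb card by (auto simp: C.solution_def)
    then show "\<exists>X. C.solution k t X" ..
  qed
qed

lemma run_if_returns:
  assumes "0 < length p" "returns p 0 [x] r b"
  shows "\<exists>c\<le>b + 2. run p x r c"
proof -
  obtain c where c: "c \<le> b" "eval p [x] (p ! 0) r c" using assms(2) unfolding returns_def by blast
  have "evals p [x] [VarE 0] [x] (1 + 0)"
    using evals_Cons[OF eval_Var[of 0 "[x]" p] evals_Nil] by simp
  then have "run p x r (1 + 0 + c + 1)" unfolding run_def using eval_Call[OF assms(1) _ c(2)] by blast
  then show ?thesis using c(1) by (intro exI[of _ "1 + 0 + c + 1"]) simp
qed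

lemma cut_program_runs:
  assumes "(G, k, t) \<in> cut_instances"
  defines "n \<equiv> card (pverts G)"
  shows "\<exists>v c. run cut_program (enc_cut_instance (G, k, t)) v c \<and>
    c \<le> total_cost n (Suc (min t n + min t n)) + 2 \<and> (v \<noteq> Null \<longleftrightarrow> cutting_at_most_k_vertices (G, k, t))"
proof -
  have G: "pair_graph G" and k: "k \<ge> 1" using assms(1) by (auto simp: cut_instances_def)
  interpret pair_graph G by (rule G)
  let ?vs = "sorted_list_of_set (pverts G)"
  have fin: "finite (pverts G)" using finite_verts by simp
  have len: "length ?vs = n" by (simp add: n_def)
  let ?E = "\<lambda>i j. (?vs ! i, ?vs ! j) \<in> parcs G"
  let ?R = "\<lambda>i j. i = j \<or> i < length ?vs \<and> j < length ?vs \<and> ?E i j"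
  have vs: "distinct ?vs" "set ?vs = pverts G" using fin by auto
  note sol = solution_iff_cutting(1)[OF G vs, of k t, unfolded len]
  interpret C: reflexive_graph n ?R by (rule solution_iff_cutting(2)[OF G vs])
  have map_vs: "map f ?vs = map (\<lambda>i. f (?vs ! i)) [0..<n]" for f :: "nat \<Rightarrow> val"
    using map_nth[of ?vs] len by (metis (no_types, lifting) map_map comp_apply map_eq_conv)
  have enc: "enc_graph G = enc_list (map (\<lambda>u. C.enc_set {v. ?E u v}) [0..<n])"
    unfolding enc_graph_def Let_def map_vs C.enc_set_def by simp
  have "yields main_fn [enc_cut_instance (G, k, t)]
    (enc_bool (C.decide (min k n) (min t n))) (total_cost n (Suc (min t n + min t n)))"
    unfolding enc_cut_instance.simps enc by (rule C.main_fn) (simp add: n_def)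
  then obtain c where c: "c \<le> total_cost n (Suc (min t n + min t n)) + 2"
    "run cut_program (enc_cut_instance (G, k, t)) (enc_bool (C.decide (min k n) (min t n))) c"
    using run_if_returns[of cut_program] fn_less_length(1) unfolding main_fn_def by blast
  moreover have "enc_bool (C.decide (min k n) (min t n)) \<noteq> Null \<longleftrightarrow> cutting_at_most_k_vertices (G, k, t)"
    unfolding enc_bool_simps(1) not_not
    using C.decide_min_iff[OF k, of t] sol unfolding len by simp
  ultimately show ?thesis by blast
qed

section \<open>Polynomial bounds and the parameter function\<close>

definition poly_bounded :: "(nat \<Rightarrow> nat) \<Rightarrow> bool" where
  "poly_bounded f \<longleftrightarrow> (\<exists>C d. \<forall>n. f n \<le> C * (n + 1) ^ d)"

lemma poly_bounded_const [intro]: "poly_bounded (\<lambda>_. c)"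
  unfolding poly_bounded_def by (intro exI[of _ c] exI[of _ 0]) simp

lemma poly_bounded_id [intro]: "poly_bounded (\<lambda>n. n)"
  unfolding poly_bounded_def by (intro exI[of _ 1] exI[of _ 1]) simp

lemma poly_bounded_add [intro]:
  assumes "poly_bounded f" "poly_bounded g"
  shows "poly_bounded (\<lambda>n. f n + g n)"
proof -
  obtain C d C' d' where C: "\<And>n. f n \<le> C * (n + 1) ^ d" "\<And>n. g n \<le> C' * (n + 1) ^ d'"
    using assms unfolding poly_bounded_def by blast
  have "f n + g n \<le> (C + C') * (n + 1) ^ (d + d')" for n
  proof -
    have "C * (n + 1) ^ d \<le> C * (n + 1) ^ (d + d')" "C' * (n + 1) ^ d' \<le> C' * (n + 1) ^ (d + d')"
      by (intro mult_le_mono2 power_increasing; simp)+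
    then show ?thesis using C(1)[of n] C(2)[of n] unfolding add_mult_distrib by linarith
  qed
  then show ?thesis unfolding poly_bounded_def by blast
qed

lemma poly_bounded_mult [intro]:
  assumes "poly_bounded f" "poly_bounded g"
  shows "poly_bounded (\<lambda>n. f n * g n)"
proof -
  obtain C d C' d' where C: "\<And>n. f n \<le> C * (n + 1) ^ d" "\<And>n. g n \<le> C' * (n + 1) ^ d'"
    using assms unfolding poly_bounded_def by blast
  have "f n * g n \<le> (C * C') * (n + 1) ^ (d + d')" for n
    using mult_le_mono[OF C(1)[of n] C(2)[of n]] by (simp add: power_add algebra_simps)
  then show ?thesis unfolding poly_bounded_def by blast
qed

lemma total_cost_le:
  "\<exists>C d. \<forall>n t. total_cost n (Suc (min t n + min t n)) + 2 \<le> C * 4 ^ t * (n + 1) ^ d"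
proof -
  define q where "q n = enum_step_cost n + solve_step_cost n" for n
  \<comment> \<open>The total cost without its exponential factor: 4 comes from two raised to
    \<open>2 * min t n + 2\<close>, which is \<open>4 * 4 ^ min t n\<close>; 106 is the 100 of
    \<open>seed_cost\<close> plus 6 per loop round, and 402 includes the 2 for the initial
    call.\<close>
  define r where "r n = n * (4 * q n + lin n + 106) + 2 * (n * (60 * n + 120) + 20) + n * (lin n + 50)
    + 100 * n + 402" for n
  have "poly_bounded r"
    unfolding r_def q_def enum_step_cost_def solve_step_cost_def best_cost_def cut_size_cost_def
      cut_cost_def augment_cost_def reach_cost_def outer_cost_def inner_cost_def boundary_cost_def lin_def
    by (intro poly_bounded_add poly_bounded_mult poly_bounded_const poly_bounded_id)
  then obtain C d where C: "\<And>n. r n \<le> C * (n + 1) ^ d" unfolding poly_bounded_def by blast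
  have "total_cost n (Suc (min t n + min t n)) + 2 \<le> C * 4 ^ t * (n + 1) ^ d" for n t
  proof -
    let ?m = "Suc (min t n + min t n)"
    have "(2::nat) ^ Suc ?m = 4 * 4 ^ min t n"
      by (simp add: power_add power_mult_distrib[symmetric])
    also have "\<dots> \<le> 4 * 4 ^ t" by (simp add: power_increasing)
    finally have p: "(2::nat) ^ Suc ?m \<le> 4 * 4 ^ t" .
    have br: "branching_cost x ?m \<le> x * (4 * 4 ^ t)" for x
      using branching_cost[of x ?m] mult_le_mono2[OF p, of x] by linarith
    have "seed_cost n ?m + 6 \<le> q n * (4 * 4 ^ t) + lin n + 106"
      using br[of "enum_step_cost n"] br[of "solve_step_cost n"]
      unfolding seed_cost_def q_def add_mult_distrib by linarith
    also have "\<dots> \<le> (4 * q n + lin n + 106) * 4 ^ t"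
    proof -
      have "(lin n + 106) * 1 \<le> (lin n + 106) * 4 ^ t" by (intro mult_le_mono2) simp
      then show ?thesis by (simp add: algebra_simps)
    qed
    finally have s: "n * (seed_cost n ?m + 6) \<le> n * (4 * q n + lin n + 106) * 4 ^ t"
      using mult_le_mono2[of "seed_cost n ?m + 6" _ n] by (simp add: mult.assoc)
    define z where "z = 2 * (n * (60 * n + 120) + 20) + n * (lin n + 50) + 100 * n + 402"
    have "z * 1 \<le> z * 4 ^ t" by (intro mult_le_mono2) simp
    moreover have "total_cost n ?m + 2 = n * (seed_cost n ?m + 6) + z"
      by (simp add: total_cost_def z_def)
    moreover have "r n * 4 ^ t = n * (4 * q n + lin n + 106) * 4 ^ t + z * 4 ^ t"
      by (simp add: r_def z_def flip: add_mult_distrib)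
    ultimately have "total_cost n ?m + 2 \<le> r n * 4 ^ t" using s by linarith
    also have "\<dots> \<le> C * (n + 1) ^ d * 4 ^ t" by (intro mult_le_mono1 C)
    finally show ?thesis by (simp add: algebra_simps)
  qed
  then show ?thesis by blast
qed

text \<open>
  The binary representation of \<open>4 ^ (m + c)\<close> consists of \<open>2 (m + c)\<close> zeros and a one. The
  program prepends two zeros to its accumulator (variable 1) for every unit of the number in
  variable 0, doubling the remaining digits by calling itself twice on them.
\<close>

definition power_program :: "nat \<Rightarrow> program" where
  "power_program c =
    [CallE 1 [VarE 0, ((\<lambda>e. CellE NullE (CellE NullE e)) ^^ c) (CellE TrueE NullE)],
     IfE (VarE 0)
       (CallE 1 [SndE (VarE 0), CallE 1 [SndE (VarE 0),
          IfE (FstE (VarE 0)) (CellE NullE (CellE NullE (VarE 1))) (VarE 1)]])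
       (VarE 1)]"

lemma bits_four_power: "map enc_bool (bits (4 ^ m)) = replicate (2 * m) Null @ [Cell Null Null]"
proof (induction m)
  case 0
  have "bits 0 = []" by (subst bits.simps) simp
  then have "bits 1 = [True]" by (subst bits.simps) simp
  then show ?case by (simp add: enc_bool_True)
next
  case (Suc m)
  have "bits (4 ^ Suc m) = False # bits (2 * 4 ^ m)" by (subst bits.simps) simp
  moreover have "bits (2 * 4 ^ m) = False # bits (4 ^ m)" by (subst bits.simps) simp
  ultimately show ?case using Suc by simp
qed

lemma power_program_loop:
  "\<exists>b. returns (power_program c) 1 [enc_nat m, enc_list xs] (enc_list (replicate (2 * m) Null @ xs)) b"
proof (induction m arbitrary: xs rule: less_induct)
  case (less m)
  have P: "power_program c ! Suc 0 = IfE (VarE 0)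
       (CallE 1 [SndE (VarE 0), CallE 1 [SndE (VarE 0),
          IfE (FstE (VarE 0)) (CellE NullE (CellE NullE (VarE 1))) (VarE 1)]])
       (VarE 1)" "Suc 0 < length (power_program c)" by (simp_all add: power_program_def)
  show ?case
  proof (cases "m = 0")
    case True
    then have "bits m = []" by (subst bits.simps) simp
    then show ?thesis using True by (intro exI[of _ 3] returnsI) (simp add: P enc_nat_def)
  next
    case False
    then have bits: "bits m = odd m # bits (m div 2)" by (subst bits.simps) simp
    let ?xs = "if odd m then Null # Null # xs else xs"
    obtain b1 b2 where
      1: "returns (power_program c) 1 [enc_nat (m div 2), enc_list ?xs]
        (enc_list (replicate (2 * (m div 2)) Null @ ?xs)) b1" and
      2: "returns (power_program c) 1 [enc_nat (m div 2), enc_list (replicate (2 * (m div 2)) Null @ ?xs)]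
        (enc_list (replicate (2 * (m div 2)) Null @ replicate (2 * (m div 2)) Null @ ?xs)) b2"
      using less[of "m div 2"] False by (metis div_less_dividend gr0I one_less_numeral_iff semiring_norm(76))
    \<comment> \<open>Each of the two calls prepends \<open>2 * (m div 2)\<close> zeros and an odd
      digit adds two more, in total \<open>4 * (m div 2) + 2 * (m mod 2) = 2 * m\<close>.\<close>
    have eq: "replicate (2 * (m div 2)) Null @ replicate (2 * (m div 2)) Null @ ?xs = replicate (2 * m) Null @ xs"
    proof (cases "odd m")
      case True
      then obtain h where m: "m = 2 * h + 1" by (elim oddE)
      then have "m div 2 = h" "2 * m = 2 * h + (2 * h + 2)" by simp_all
      then show ?thesis using True by (simp only: replicate_add) (simp add: numeral_2_eq_2)
    next
      case False
      then obtain h where m: "m = 2 * h" by (auto elim: evenE)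
      then have "m div 2 = h" "2 * m = 2 * h + 2 * h" by simp_all
      then show ?thesis using False by (simp only: replicate_add) simp
    qed
    note r1 = returns_call[OF 1] and r2 = returns_call[OF 2]
    have m: "enc_nat m = Cell (enc_bool (odd m)) (enc_nat (m div 2))" by (simp add: enc_nat_def bits)
    show ?thesis
    proof (intro exI returnsI)
      show "wp (power_program c) [enc_nat m, enc_list xs] (power_program c ! 1)
        (\<lambda>v b. v = enc_list (replicate (2 * m) Null @ xs) \<and> b \<le> b1 + b2 + 30)"
        using returns_cost[OF 1] returns_cost[OF 2] r1 r2 unfolding eq
        by (cases "odd m") (simp_all add: P m)
    qed
  qed
qed

lemma computable_four_power: "computable (\<lambda>m. 4 ^ (m + c))"
  unfolding computable_def
proof (intro exI[of _ "power_program c"] allI)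
  fix m
  let ?p = "power_program c" and ?s = "\<lambda>e. CellE NullE (CellE NullE e)"
  have start: "\<exists>b. eval ?p env ((?s ^^ j) (CellE TrueE NullE)) (enc_list (replicate (2 * j) Null @ [Cell Null Null])) b"
    for env j
  proof (induction j)
    case 0
    show ?case by (auto intro!: exI eval_Cell eval_Null)
  next
    case (Suc j)
    then obtain b where "eval ?p env ((?s ^^ j) (CellE TrueE NullE)) (enc_list (replicate (2 * j) Null @ [Cell Null Null])) b" ..
    then show ?case by (auto intro!: exI eval_Cell eval_Null)
  qed
  obtain b1 where 1: "eval ?p [enc_nat m] ((?s ^^ c) (CellE TrueE NullE)) (enc_list (replicate (2 * c) Null @ [Cell Null Null])) b1"
    using start by blast
  obtain b2 where 2: "eval ?p [enc_nat m, enc_list (replicate (2 * c) Null @ [Cell Null Null])] (?p ! 1)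
      (enc_list (replicate (2 * m) Null @ replicate (2 * c) Null @ [Cell Null Null])) b2"
    using power_program_loop[of c m] unfolding returns_def by blast
  have "replicate (2 * m) Null @ replicate (2 * c) Null = replicate (2 * (m + c)) Null"
    by (simp add: replicate_add[symmetric] add_mult_distrib2)
  then have out: "enc_list (replicate (2 * m) Null @ replicate (2 * c) Null @ [Cell Null Null]) = enc_nat (4 ^ (m + c))"
    by (simp add: enc_nat_def bits_four_power flip: append_assoc)
  have len: "0 < length ?p" "1 < length ?p" by (simp_all add: power_program_def)
  have args: "evals ?p [enc_nat m] [VarE 0, (?s ^^ c) (CellE TrueE NullE)]
      [enc_nat m, enc_list (replicate (2 * c) Null @ [Cell Null Null])] (1 + (b1 + 0))"
    using evals_Cons[OF eval_Var[of 0 "[enc_nat m]" ?p] evals_Cons[OF 1 evals_Nil]] by simp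
  have "?p ! 0 = CallE 1 [VarE 0, (?s ^^ c) (CellE TrueE NullE)]" by (simp add: power_program_def)
  then have "returns ?p 0 [enc_nat m] (enc_nat (4 ^ (m + c))) (1 + (b1 + 0) + b2 + 1)"
    using eval_Call[OF len(2) args 2] unfolding out returns_def by auto
  then show "\<exists>b. run ?p (enc_nat m) (enc_nat (4 ^ (m + c))) b" using run_if_returns[OF len(1)] by blast
qed

theorem theorem2:
  shows "(\<exists>p C d. decides_within p cut_instances enc_cut_instance cutting_at_most_k_vertices
            (\<lambda>x. C * 4 ^ cut_bound x * (num_vertices x + 1) ^ d))
       \<and> fixed_parameter_tractable cut_instances enc_cut_instance num_vertices cut_bound
            cutting_at_most_k_vertices"
proof -
  obtain C d where C: "\<And>n t. total_cost n (Suc (min t n + min t n)) + 2 \<le> C * 4 ^ t * (n + 1) ^ d"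
    using total_cost_le by blast
  have dec: "decides_within cut_program cut_instances enc_cut_instance cutting_at_most_k_vertices
      (\<lambda>x. C * 4 ^ cut_bound x * (num_vertices x + 1) ^ d)"
    unfolding decides_within_def
  proof
    fix x :: cut_instance assume "x \<in> cut_instances"
    moreover obtain G k t where x: "x = (G, k, t)" by (cases x)
    ultimately obtain v c where "run cut_program (enc_cut_instance x) v c"
      "c \<le> total_cost (card (pverts G)) (Suc (min t (card (pverts G)) + min t (card (pverts G)))) + 2"
      "v \<noteq> Null \<longleftrightarrow> cutting_at_most_k_vertices x"
      using cut_program_runs[of G k t] by blast
    then show "\<exists>v c. run cut_program (enc_cut_instance x) v c \<and>
        c \<le> C * 4 ^ cut_bound x * (num_vertices x + 1) ^ d \<and> (v \<noteq> Null \<longleftrightarrow> cutting_at_most_k_vertices x)"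
      using C[of "card (pverts G)" t] le_trans unfolding x num_vertices.simps cut_bound.simps by blast
  qed
  \<comment> \<open>\<open>fixed_parameter_tractable\<close> leaves no room for a constant beside
    \<open>f\<close>, so \<open>C\<close> moves into the exponent; this is the shift built into
    \<open>power_program\<close>.\<close>
  have "C \<le> 4 ^ C" by (rule less_imp_le[OF less_le_trans[OF less_exp power_mono]]) auto
  then have "C * 4 ^ t * (n + 1) ^ d \<le> 4 ^ (t + C) * (n + 1) ^ d" for t n :: nat
    by (simp add: power_add mult.commute)
  then have "decides_within cut_program cut_instances enc_cut_instance cutting_at_most_k_vertices
      (\<lambda>x. 4 ^ (cut_bound x + C) * (num_vertices x + 1) ^ d)"
    using dec le_trans unfolding decides_within_def by meson
  then have "fixed_parameter_tractable cut_instances enc_cut_instance num_vertices cut_bound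
      cutting_at_most_k_vertices"
    unfolding fixed_parameter_tractable_def
    using computable_four_power[of C]
    by (intro exI[of _ cut_program] exI[of _ "\<lambda>m. 4 ^ (m + C)"] exI[of _ d]) simp
  then show ?thesis using dec by blast
qed

end
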